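(* Let $n,k\ge1$. A square Hermitian orthogonal design $\mathcal{O}_x$ of size $[n,n,2k]$ exists if and only if $2^{k-1}\mid n$. Moreover, for any such $\mathcal{O}_x$ there exist $U,V\in U_n(\mathbb{C})$ and unique nonnegative integers $n_1,n_2$ with $n_1+n_2=n/2^{k-1}$ such that $$\mathcal{O}_x=U\,\mathrm{diag}(\underbrace{\mathcal{H}_{2k},\ldots,\mathcal{H}_{2k}}_{n_1},\underbrace{\mathcal{H}^-_{2k},\ldots,\mathcal{H}^-_{2k}}_{n_2})\,V=U\big((I_{n_1}\otimes\mathcal{H}_{2k})\oplus(I_{n_2}\otimes\mathcal{H}^-_{2k})\big)V.$$
   Context: Let $x_1,x_2,\ldots$ be formal real indeterminates. A Hermitian orthogonal design (HOD) of size $[p,n,m]$ is a $p\times n$ matrix $\mathcal{O}_x$ whose entries are complex linear combinations of $x_1,\ldots,x_m$ such that $\mathcal{O}_x^H\mathcal{O}_x=(x_1^2+\cdots+x_m^2)I_n$; it is square if $p=n$. Define $\mathcal{H}_2=(x_1+x_2\sqrt{-1})$ and for $k>1$ the $2^{k-1}\times2^{k-1}$ matrix $$\mathcal{H}_{2k}=\begin{pmatrix}\mathcal{H}_{2k-2} & (x_{2k-1}+x_{2k}\sqrt{-1})I_{2^{k-2}}\\ -(x_{2k-1}-x_{2k}\sqrt{-1})I_{2^{k-2}} & \mathcal{H}_{2k-2}^H\end{pmatrix},$$ where $^H$ is conjugate transpose with the $x_i$ treated as real. Let $\mathcal{H}_{2k}^-$ be obtained from $\mathcal{H}_{2k}$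 by replacing $x_{2k}$ with $-x_{2k}$. $U_n(\mathbb{C})$ is the group of $n\times n$ unitary matrices. *)

theory Defs
  imports Complex_Main "Jordan_Normal_Form.Schur_Decomposition"
begin

text \<open>A p x n matrix whose entries are complex linear combinations of the real
  indeterminates x_1,...,x_m; the indeterminate x_i is represented by x (i-1),
  and the coefficient of x_(i+1) in entry (r,s) is C i r s.\<close>
definition design_mat :: "nat \<Rightarrow> nat \<Rightarrow> nat \<Rightarrow> (nat \<Rightarrow> nat \<Rightarrow> nat \<Rightarrow> complex) \<Rightarrow> (nat \<Rightarrow> real) \<Rightarrow> complex mat" where
  "design_mat p n m C x = mat p n (\<lambda>(r,s). \<Sum>i<m. complex_of_real (x i) * C i r s)"

definition is_HOD :: "nat \<Rightarrow> nat \<Rightarrow> nat \<Rightarrow> (nat \<Rightarrow> nat \<Rightarrow> nat \<Rightarrow> complex) \<Rightarrow> bool" where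
  "is_HOD p n m C \<longleftrightarrow>
     (\<forall>x :: nat \<Rightarrow> real. mat_adjoint (design_mat p n m C x) * design_mat p n m C x
        = complex_of_real (\<Sum>i<m. (x i)^2) \<cdot>\<^sub>m 1\<^sub>m n)"

definition unitary_mat :: "nat \<Rightarrow> complex mat \<Rightarrow> bool" where
  "unitary_mat n U \<longleftrightarrow> U \<in> carrier_mat n n \<and> mat_adjoint U * U = 1\<^sub>m n \<and> U * mat_adjoint U = 1\<^sub>m n"

text \<open>Hmat k x is the matrix H_{2k} (of size 2^(k-1)), for k \<ge> 1.\<close>
fun Hmat :: "nat \<Rightarrow> (nat \<Rightarrow> real) \<Rightarrow> complex mat" where
  "Hmat 0 x = 0\<^sub>m 0 0"
| "Hmat (Suc 0) x = mat 1 1 (\<lambda>_. Complex (x 0) (x 1))"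
| "Hmat (Suc (Suc j)) x =
     (let A = Hmat (Suc j) x; d = 2 ^ j
      in four_block_mat A (Complex (x (2*j+2)) (x (2*j+3)) \<cdot>\<^sub>m 1\<^sub>m d)
           ((- Complex (x (2*j+2)) (- x (2*j+3))) \<cdot>\<^sub>m 1\<^sub>m d) (mat_adjoint A))"

definition Hminus :: "nat \<Rightarrow> (nat \<Rightarrow> real) \<Rightarrow> complex mat" where
  "Hminus k x = Hmat k (x(2*k-1 := - x (2*k-1)))"

end

theory Submission
  imports Defs
begin

text \<open>Write \<open>hdouble z A\<close> for the block matrix with rows \<open>(A, z)\<close> and \<open>(-cnj z, A\<^sup>H)\<close>. If the coefficient
  matrices of a design are \<open>A\<^sub>1, \<dots>, A\<^bsub>2k\<^esub>\<close>, then \<open>E = A\<^bsub>2k-1\<^esub>\<^sup>H A\<^bsub>2k\<^esub>\<close> is unitary and skew-Hermitian, hence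
  unitarily similar to \<open>diag(-\<i>I, \<i>I)\<close>, and it anticommutes with the remaining \<open>A\<^bsub>2k-1\<^esub>\<^sup>H A\<^sub>i\<close>. In an
  eigenbasis of \<open>E\<close> the latter are therefore block antidiagonal, which forces the two eigenspaces to have equal
  dimension and exhibits the design as unitarily equivalent to \<open>hdouble z D\<close> for a design \<open>D\<close> of half the size
  in two fewer variables. Induction reduces to \<open>k = 1\<close>, where the sign pattern of the eigenvalues of \<open>E\<close> gives
  \<open>n\<^sub>1\<close> and \<open>n\<^sub>2\<close>. Doubling is compatible with direct sums and turns \<open>\<H>\<^sup>-\<close> into \<open>\<H>\<^sup>-\<close> up to equivalence, and it
  reflects equivalence, so that uniqueness also descends to \<open>k = 1\<close>, where it is invariance of the trace.\<close>

subsection \<open>Adjoints, block matrices and unitary matrices\<close>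

lemma mat_adjoint_eq: "mat_adjoint A = mat (dim_col A) (dim_row A) (\<lambda>(i, j). cnj (A $$ (j, i)))"
  unfolding mat_adjoint_def by (rule eq_matI) (simp_all add: mat_of_rows_index)

lemma dim_mat_adjoint [simp]: "dim_row (mat_adjoint A) = dim_col A" "dim_col (mat_adjoint A) = dim_row A"
  for A :: "complex mat"
  by (simp_all add: mat_adjoint_eq)

lemma mat_adjoint_carrier [simp]:
  "A \<in> carrier_mat m n \<Longrightarrow> mat_adjoint A \<in> carrier_mat n m" for A :: "complex mat"
  by (rule carrier_matI) auto

lemma index_mat_adjoint [simp]:
  "i < dim_col A \<Longrightarrow> j < dim_row A \<Longrightarrow> mat_adjoint A $$ (i, j) = cnj (A $$ (j, i))"
  by (simp add: mat_adjoint_eq)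

lemma mat_adjoint_adjoint [simp]: "mat_adjoint (mat_adjoint A) = (A :: complex mat)"
  by (rule eq_matI) auto

lemma mat_adjoint_mult:
  fixes A B :: "complex mat"
  assumes "A \<in> carrier_mat m n" "B \<in> carrier_mat n l"
  shows "mat_adjoint (A * B) = mat_adjoint B * mat_adjoint A"
  using assms by (intro eq_matI) (auto simp: scalar_prod_def mult.commute)

lemma mat_adjoint_one [simp]: "mat_adjoint (1\<^sub>m n) = (1\<^sub>m n :: complex mat)"
  by (rule eq_matI) auto

lemma mat_adjoint_zero [simp]: "mat_adjoint (0\<^sub>m m n) = (0\<^sub>m n m :: complex mat)"
  by (rule eq_matI) auto

lemma mat_adjoint_smult: "mat_adjoint (c \<cdot>\<^sub>m A) = cnj c \<cdot>\<^sub>m mat_adjoint A"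
  by (rule eq_matI) auto

lemma mat_adjoint_four_block:
  fixes A B C D :: "complex mat"
  assumes "A \<in> carrier_mat m1 n1" "B \<in> carrier_mat m1 n2" "C \<in> carrier_mat m2 n1" "D \<in> carrier_mat m2 n2"
  shows "mat_adjoint (four_block_mat A B C D)
    = four_block_mat (mat_adjoint A) (mat_adjoint C) (mat_adjoint B) (mat_adjoint D)"
  using assms by (intro eq_matI) auto

lemma four_block_mat_eqD:
  assumes "four_block_mat A B C D = four_block_mat A' B' C' D'"
    and "A \<in> carrier_mat m1 n1" "B \<in> carrier_mat m1 n2" "C \<in> carrier_mat m2 n1" "D \<in> carrier_mat m2 n2"
    and "A' \<in> carrier_mat m1 n1" "B' \<in> carrier_mat m1 n2" "C' \<in> carrier_mat m2 n1" "D' \<in> carrier_mat m2 n2"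
  shows "A = A'" "B = B'" "C = C'" "D = D'"
proof -
  have *: "four_block_mat A B C D $$ (i, j) = four_block_mat A' B' C' D' $$ (i, j)" for i j
    using assms(1) by simp
  show "A = A'"
  proof (rule eq_matI)
    fix i j assume "i < dim_row A'" "j < dim_col A'"
    then show "A $$ (i, j) = A' $$ (i, j)" using *[of i j] assms(2-) by auto
  qed (use assms in auto)
  show "B = B'"
  proof (rule eq_matI)
    fix i j assume "i < dim_row B'" "j < dim_col B'"
    then show "B $$ (i, j) = B' $$ (i, j)" using *[of i "j + n1"] assms(2-) by auto
  qed (use assms in auto)
  show "C = C'"
  proof (rule eq_matI)
    fix i j assume "i < dim_row C'" "j < dim_col C'"
    then show "C $$ (i, j) = C' $$ (i, j)" using *[of "i + m1" j] assms(2-) by auto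
  qed (use assms in auto)
  show "D = D'"
  proof (rule eq_matI)
    fix i j assume "i < dim_row D'" "j < dim_col D'"
    then show "D $$ (i, j) = D' $$ (i, j)" using *[of "i + m1" "j + n1"] assms(2-) by auto
  qed (use assms in auto)
qed

text \<open>Premises on dimensions replace carrier membership, so that rewriting can discharge them
  without guessing an intermediate size.\<close>

lemma mult_mat_assoc:
  fixes A :: "'a :: semiring_0 mat"
  shows "dim_col A = dim_row B \<Longrightarrow> dim_col B = dim_row C \<Longrightarrow> A * B * C = A * (B * C)"
  by (rule assoc_mult_mat[OF carrier_matI carrier_matI carrier_matI]) auto

lemma zero_mat_simps [simp]:
  fixes A :: "'a :: semiring_1 mat"
  shows "dim_row A = n \<Longrightarrow> 0\<^sub>m m n * A = 0\<^sub>m m (dim_col A)"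
    "dim_col A = m \<Longrightarrow> A * 0\<^sub>m m n = 0\<^sub>m (dim_row A) n"
    "dim_row A = m \<Longrightarrow> dim_col A = n \<Longrightarrow> A + 0\<^sub>m m n = A"
    "dim_row A = m \<Longrightarrow> dim_col A = n \<Longrightarrow> 0\<^sub>m m n + A = A"
    "c \<cdot>\<^sub>m 0\<^sub>m m n = (0\<^sub>m m n :: 'a mat)"
    "dim_row A = n \<Longrightarrow> 1\<^sub>m n * A = A"
    "dim_col A = m \<Longrightarrow> A * 1\<^sub>m m = A"
  by (rule eq_matI; auto)+

lemma smult_mat_mult [simp]:
  fixes A :: "'a :: comm_semiring_1 mat"
  shows "dim_col A = dim_row B \<Longrightarrow> (c \<cdot>\<^sub>m A) * B = c \<cdot>\<^sub>m (A * B)"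
    "dim_col A = dim_row B \<Longrightarrow> A * (c \<cdot>\<^sub>m B) = c \<cdot>\<^sub>m (A * B)"
    "c \<cdot>\<^sub>m (d \<cdot>\<^sub>m A) = (c * d) \<cdot>\<^sub>m A"
    "1 \<cdot>\<^sub>m A = A"
  by (rule eq_matI; auto simp: scalar_prod_def sum_distrib_left ac_simps)+

text \<open>Cyclicity of the trace, with the trace spelled out as a diagonal sum; it supplies the
  invariant that separates the multiplicities when \<open>k = 1\<close>.\<close>

lemma sum_diag_mult_comm:
  fixes A B :: "'a :: comm_semiring_0 mat"
  assumes "A \<in> carrier_mat m n" "B \<in> carrier_mat n m"
  shows "(\<Sum>i<m. (A * B) $$ (i, i)) = (\<Sum>i<n. (B * A) $$ (i, i))"
proof -
  have "(\<Sum>i<m. (A * B) $$ (i, i)) = (\<Sum>i<m. \<Sum>j<n. A $$ (i, j) * B $$ (j, i))"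
    using assms by (auto simp: scalar_prod_def lessThan_atLeast0 intro!: sum.cong)
  also have "\<dots> = (\<Sum>j<n. \<Sum>i<m. B $$ (j, i) * A $$ (i, j))"
    by (subst sum.swap) (simp add: mult.commute)
  also have "\<dots> = (\<Sum>i<n. (B * A) $$ (i, i))"
    using assms by (auto simp: scalar_prod_def lessThan_atLeast0 intro!: sum.cong)
  finally show ?thesis .
qed

lemma unitary_matD:
  assumes "unitary_mat n U"
  shows "U \<in> carrier_mat n n" "mat_adjoint U \<in> carrier_mat n n" "dim_row U = n" "dim_col U = n"
    "mat_adjoint U * U = 1\<^sub>m n" "U * mat_adjoint U = 1\<^sub>m n"
  using assms by (auto simp: unitary_mat_def)

lemma unitary_mat_cancel:
  assumes "unitary_mat n U"
  shows "dim_row X = n \<Longrightarrow> mat_adjoint U * (U * X) = X"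
    "dim_row X = n \<Longrightarrow> U * (mat_adjoint U * X) = X"
  using unitary_matD[OF assms]
  by (simp_all add: mult_mat_assoc[symmetric])

lemma unitary_mat_adjoint: "unitary_mat n U \<Longrightarrow> unitary_mat n (mat_adjoint U)"
  by (auto simp: unitary_mat_def)

lemma unitary_mat_one: "unitary_mat n (1\<^sub>m n)"
  by (auto simp: unitary_mat_def)

text \<open>For square matrices over a field a one-sided inverse is two-sided.\<close>

lemma unitary_mat_leftI:
  assumes "U \<in> carrier_mat n n" "mat_adjoint U * U = 1\<^sub>m n"
  shows "unitary_mat n U"
  using assms mat_mult_left_right_inverse[of "mat_adjoint U" n U] by (auto simp: unitary_mat_def)

lemma unitary_mat_mult:
  assumes "unitary_mat n U" "unitary_mat n V"
  shows "unitary_mat n (U * V)"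
proof (rule unitary_mat_leftI)
  note [simp] = unitary_matD[OF assms(1)] unitary_matD[OF assms(2)]
  show "U * V \<in> carrier_mat n n" by (rule mult_carrier_mat[of _ n n]) simp_all
  show "mat_adjoint (U * V) * (U * V) = 1\<^sub>m n"
    by (simp add: mat_adjoint_mult[of _ n n _ n] mult_mat_assoc
        unitary_mat_cancel[OF assms(1)])
qed

lemma unitary_mat_block_diag:
  assumes "unitary_mat m U" "unitary_mat n V"
  shows "unitary_mat (m + n) (four_block_mat U (0\<^sub>m m n) (0\<^sub>m n m) V)"
proof -
  note [simp] = unitary_matD[OF assms(1)] unitary_matD[OF assms(2)]
  show ?thesis
    by (rule unitary_mat_leftI)
      (simp_all add: mat_adjoint_four_block[of _ m m _ n _ n] mult_four_block_mat[of _ m m _ n _ n _ _ m _ n])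
qed

text \<open>Exchange of two halves with unimodular weights; the weights provide the signs required
  when the halves of a doubled matrix trade places.\<close>

lemma unitary_mat_block_antidiag:
  assumes "c * cnj c = 1" "d * cnj d = 1"
  shows "unitary_mat (n + n) (four_block_mat (0\<^sub>m n n) (c \<cdot>\<^sub>m 1\<^sub>m n) (d \<cdot>\<^sub>m 1\<^sub>m n) (0\<^sub>m n n))"
proof (rule unitary_mat_leftI)
  have eq: "cnj c * c = 1" "cnj d * d = 1" using assms by (simp_all add: mult.commute)
  have adj: "mat_adjoint (four_block_mat (0\<^sub>m n n) (c \<cdot>\<^sub>m 1\<^sub>m n) (d \<cdot>\<^sub>m 1\<^sub>m n) (0\<^sub>m n n))
    = four_block_mat (0\<^sub>m n n) (cnj d \<cdot>\<^sub>m 1\<^sub>m n) (cnj c \<cdot>\<^sub>m 1\<^sub>m n) (0\<^sub>m n n)"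
    by (simp add: mat_adjoint_four_block[of _ n n _ n _ n] mat_adjoint_smult)
  show "mat_adjoint (four_block_mat (0\<^sub>m n n) (c \<cdot>\<^sub>m 1\<^sub>m n) (d \<cdot>\<^sub>m 1\<^sub>m n) (0\<^sub>m n n)) *
    four_block_mat (0\<^sub>m n n) (c \<cdot>\<^sub>m 1\<^sub>m n) (d \<cdot>\<^sub>m 1\<^sub>m n) (0\<^sub>m n n) = 1\<^sub>m (n + n)"
    unfolding adj
    by (subst mult_four_block_mat[of _ n n _ n _ n _ _ n _ n]) (simp_all add: eq assms four_block_one_mat)
  show "four_block_mat (0\<^sub>m n n) (c \<cdot>\<^sub>m 1\<^sub>m n) (d \<cdot>\<^sub>m 1\<^sub>m n) (0\<^sub>m n n) \<in> carrier_mat (n + n) (n + n)"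
    by (rule carrier_matI) simp_all
qed

section \<open>Permutation matrices and simultaneous relabelling of rows and columns\<close>

definition reindex_mat :: "nat \<Rightarrow> (nat \<Rightarrow> nat) \<Rightarrow> complex mat" where
  "reindex_mat n f = mat n n (\<lambda>(i, j). if j = f i then 1 else 0)"

lemma reindex_mat_mult:
  assumes "M \<in> carrier_mat n n" and f: "bij_betw f {..<n} {..<n}"
  shows "reindex_mat n f * M * mat_adjoint (reindex_mat n f) = mat n n (\<lambda>(i, j). M $$ (f i, f j))"
proof -
  have [simp]: "f i < n" if "i < n" for i using bij_betw_apply[OF f, of i] that by simp
  have PM: "reindex_mat n f * M = mat n n (\<lambda>(i, j). M $$ (f i, j))"
  proof (rule eq_matI)
    fix i j assume "i < dim_row (mat n n (\<lambda>(i, j). M $$ (f i, j)))" "j < dim_col (mat n n (\<lambda>(i, j). M $$ (f i, j)))"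
    then have ij: "i < n" "j < n" by auto
    then have "(reindex_mat n f * M) $$ (i, j) = (\<Sum>l\<in>{0..<n}. (if l = f i then M $$ (l, j) else 0))"
      using assms(1) by (simp add: reindex_mat_def scalar_prod_def if_distrib[of "\<lambda>c. c * _"] cong: if_cong)
    with ij show "(reindex_mat n f * M) $$ (i, j) = mat n n (\<lambda>(i, j). M $$ (f i, j)) $$ (i, j)"
      by (simp add: sum.delta)
  qed (use assms in \<open>auto simp: reindex_mat_def\<close>)
  show ?thesis unfolding PM
  proof (rule eq_matI)
    fix i j assume "i < dim_row (mat n n (\<lambda>(i, j). M $$ (f i, f j)))" "j < dim_col (mat n n (\<lambda>(i, j). M $$ (f i, f j)))"
    then have ij: "i < n" "j < n" by auto
    then have "(mat n n (\<lambda>(i, j). M $$ (f i, j)) * mat_adjoint (reindex_mat n f)) $$ (i, j)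
        = (\<Sum>l\<in>{0..<n}. (if l = f j then M $$ (f i, l) else 0))"
      by (simp add: reindex_mat_def scalar_prod_def if_distrib[of cnj] if_distrib[of "\<lambda>c. _ * c"] cong: if_cong)
    with ij show "(mat n n (\<lambda>(i, j). M $$ (f i, j)) * mat_adjoint (reindex_mat n f)) $$ (i, j)
        = mat n n (\<lambda>(i, j). M $$ (f i, f j)) $$ (i, j)"
      by (simp add: sum.delta)
  qed (auto simp: reindex_mat_def)
qed

lemma unitary_reindex_mat:
  assumes f: "bij_betw f {..<n} {..<n}"
  shows "unitary_mat n (reindex_mat n f)"
proof -
  have c: "reindex_mat n f \<in> carrier_mat n n" by (simp add: reindex_mat_def)
  have inj: "f i = f j \<longleftrightarrow> i = j" if "i < n" "j < n" for i j
    using bij_betw_imp_inj_on[OF f] that by (auto simp: inj_on_eq_iff)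
  have [simp]: "f i < n" if "i < n" for i using bij_betw_apply[OF f, of i] that by simp
  have "reindex_mat n f * mat_adjoint (reindex_mat n f) = 1\<^sub>m n"
    using reindex_mat_mult[OF one_carrier_mat f] c
    by (auto intro!: eq_matI simp: inj)
  with c have "unitary_mat n (mat_adjoint (reindex_mat n f))"
    by (intro unitary_mat_leftI) auto
  then show ?thesis
    using unitary_mat_adjoint by force
qed

subsection \<open>Unitary equivalence and doubling\<close>

text \<open>One pair \<open>U\<close>, \<open>V\<close> has to serve all \<open>x\<close> at once,
  so this relates families rather than single matrices. The size condition on \<open>N\<close>
  carries over to \<open>M\<close> through the equation.\<close>

definition unitarily_equivalent :: "nat \<Rightarrow> ('x \<Rightarrow> complex mat) \<Rightarrow> ('x \<Rightarrow> complex mat) \<Rightarrow> bool" where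
  "unitarily_equivalent n M N \<longleftrightarrow> (\<forall>x. N x \<in> carrier_mat n n) \<and>
     (\<exists>U V. unitary_mat n U \<and> unitary_mat n V \<and> (\<forall>x. M x = U * N x * V))"

lemma unitarily_equivalentI:
  assumes "\<And>x. N x \<in> carrier_mat n n" "unitary_mat n U" "unitary_mat n V" "\<And>x. M x = U * N x * V"
  shows "unitarily_equivalent n M N"
  using assms unfolding unitarily_equivalent_def by blast

lemma unitarily_equivalentE:
  assumes "unitarily_equivalent n M N"
  obtains U V where "unitary_mat n U" "unitary_mat n V" "\<And>x. M x = U * N x * V"
    "\<And>x. N x \<in> carrier_mat n n" "\<And>x. M x \<in> carrier_mat n n"
proof -
  obtain U V where *: "unitary_mat n U" "unitary_mat n V" "\<And>x. M x = U * N x * V"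
    "\<And>x. N x \<in> carrier_mat n n"
    using assms unfolding unitarily_equivalent_def by blast
  then have "M x \<in> carrier_mat n n" for x
    using unitary_matD(1)[OF *(1)] unitary_matD(1)[OF *(2)] by (auto intro!: mult_carrier_mat)
  with * that show thesis by blast
qed

lemma unitarily_equivalent_refl:
  assumes "\<And>x. M x \<in> carrier_mat n n"
  shows "unitarily_equivalent n M M"
  by (rule unitarily_equivalentI[OF assms unitary_mat_one unitary_mat_one]) (simp add: carrier_matD[OF assms])

lemma unitarily_equivalent_sym:
  assumes "unitarily_equivalent n M N"
  shows "unitarily_equivalent n N M"
proof -
  obtain U V where UV: "unitary_mat n U" "unitary_mat n V" and M: "\<And>x. M x = U * N x * V"
    and c: "\<And>x. N x \<in> carrier_mat n n" "\<And>x. M x \<in> carrier_mat n n"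
    using unitarily_equivalentE[OF assms] by metis
  note [simp] = unitary_matD[OF UV(1)] unitary_matD[OF UV(2)] carrier_matD[OF c(1)]
  show ?thesis
  proof (rule unitarily_equivalentI[OF c(2) UV[THEN unitary_mat_adjoint]])
    show "N x = mat_adjoint U * M x * mat_adjoint V" for x
      by (simp add: M mult_mat_assoc unitary_mat_cancel[OF UV(1)])
  qed
qed

lemma unitarily_equivalent_trans [trans]:
  assumes "unitarily_equivalent n L M" "unitarily_equivalent n M N"
  shows "unitarily_equivalent n L N"
proof -
  obtain U V where UV: "unitary_mat n U" "unitary_mat n V" and L: "\<And>x. L x = U * M x * V"
    using unitarily_equivalentE[OF assms(1)] by metis
  obtain U' V' where UV': "unitary_mat n U'" "unitary_mat n V'" and M: "\<And>x. M x = U' * N x * V'"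
    and c: "\<And>x. N x \<in> carrier_mat n n"
    using unitarily_equivalentE[OF assms(2)] by metis
  note [simp] = unitary_matD[OF UV(1)] unitary_matD[OF UV(2)] unitary_matD[OF UV'(1)] unitary_matD[OF UV'(2)]
     carrier_matD[OF c(1)]
  show ?thesis
    by (rule unitarily_equivalentI[OF c unitary_mat_mult[OF UV(1) UV'(1)] unitary_mat_mult[OF UV'(2) UV(2)]])
      (simp add: L M mult_mat_assoc)
qed

lemma unitarily_equivalent_block_diag:
  assumes "unitarily_equivalent m A A'" "unitarily_equivalent n B B'"
  shows "unitarily_equivalent (m + n) (\<lambda>x. four_block_mat (A x) (0\<^sub>m m n) (0\<^sub>m n m) (B x))
    (\<lambda>x. four_block_mat (A' x) (0\<^sub>m m n) (0\<^sub>m n m) (B' x))"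
proof -
  obtain U V where UV: "unitary_mat m U" "unitary_mat m V" and A: "\<And>x. A x = U * A' x * V"
    and c: "\<And>x. A' x \<in> carrier_mat m m"
    using unitarily_equivalentE[OF assms(1)] by metis
  obtain U' V' where UV': "unitary_mat n U'" "unitary_mat n V'" and B: "\<And>x. B x = U' * B' x * V'"
    and c': "\<And>x. B' x \<in> carrier_mat n n"
    using unitarily_equivalentE[OF assms(2)] by metis
  note [simp] = unitary_matD[OF UV(1)] unitary_matD[OF UV(2)] unitary_matD[OF UV'(1)] unitary_matD[OF UV'(2)]
     carrier_matD[OF c] carrier_matD[OF c'] c c'
  show ?thesis
    by (rule unitarily_equivalentI[OF _ unitary_mat_block_diag[OF UV(1) UV'(1)] unitary_mat_block_diag[OF UV(2) UV'(2)]])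
      (simp_all add: A B mult_four_block_mat[of _ m m _ n _ n _ _ m _ n] mult_carrier_mat[of _ m m _ m] mult_carrier_mat[of _ n n _ n])
qed

text \<open>The passage from \<open>\<H>\<^bsub>2k-2\<^esub>\<close> to \<open>\<H>\<^bsub>2k\<^esub>\<close>, with \<open>z\<close> in the place of the two new variables.\<close>

definition hdouble :: "complex \<Rightarrow> complex mat \<Rightarrow> complex mat" where
  "hdouble z A = four_block_mat A (z \<cdot>\<^sub>m 1\<^sub>m (dim_row A)) ((- cnj z) \<cdot>\<^sub>m 1\<^sub>m (dim_row A)) (mat_adjoint A)"

lemma hdouble_carrier [simp]: "A \<in> carrier_mat n n \<Longrightarrow> hdouble z A \<in> carrier_mat (n + n) (n + n)"
  by (simp add: hdouble_def)

text \<open>Take \<open>diag(U, V\<^sup>H)\<close> on the left and \<open>diag(V, U\<^sup>H)\<close>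
  on the right. The off-diagonal scalars survive because they meet only \<open>U U\<^sup>H\<close>
  and \<open>V\<^sup>H V\<close>, and the lower right block becomes the adjoint of
  \<open>U N V\<close>.\<close>

lemma unitarily_equivalent_hdouble:
  assumes "unitarily_equivalent n M N"
  shows "unitarily_equivalent (n + n) (\<lambda>x. hdouble (z x) (M x)) (\<lambda>x. hdouble (z x) (N x))"
proof -
  obtain U V where UV: "unitary_mat n U" "unitary_mat n V" and M: "\<And>x. M x = U * N x * V"
    and c: "\<And>x. N x \<in> carrier_mat n n"
    using unitarily_equivalentE[OF assms] by metis
  note [simp] = unitary_matD[OF UV(1)] unitary_matD[OF UV(2)] carrier_matD[OF c(1)] c
  show ?thesis
    by (rule unitarily_equivalentI[OF _ unitary_mat_block_diag[OF UV(1) unitary_mat_adjoint[OF UV(2)]]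
          unitary_mat_block_diag[OF UV(2) unitary_mat_adjoint[OF UV(1)]]])
      (simp_all add: M hdouble_def mult_four_block_mat[of _ n n _ n _ n _ _ n _ n] mult_carrier_mat[of _ n n _ n]
        mat_adjoint_mult[of _ n n _ n] mult_mat_assoc)
qed

text \<open>Exchanging the halves of rows and of columns puts the adjoint in the upper left block
  and swaps the two scalars; the signs in the exchange matrices restore the shape of a double, with
  \<open>z\<close> conjugated.\<close>

lemma hdouble_swap:
  assumes "\<And>x. M x \<in> carrier_mat n n"
  shows "unitarily_equivalent (n + n) (\<lambda>x. hdouble (z x) (M x)) (\<lambda>x. hdouble (cnj (z x)) (mat_adjoint (M x)))"
proof -
  note [simp] = carrier_matD[OF assms] assms
  show ?thesis
    by (rule unitarily_equivalentI[OF _ unitary_mat_block_antidiag[of 1 "- 1"] unitary_mat_block_antidiag[of "- 1" 1]])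
      (simp_all add: hdouble_def mult_four_block_mat[of _ n n _ n _ n _ _ n _ n])
qed

text \<open>The adjoint has rows \<open>(M\<^sup>H, -z)\<close> and \<open>(cnj z, M)\<close>, which
  is \<open>hdouble (cnj z) M\<close> with its halves exchanged, this time without signs.\<close>

lemma hdouble_adjoint:
  assumes "\<And>x. M x \<in> carrier_mat n n"
  shows "unitarily_equivalent (n + n) (\<lambda>x. mat_adjoint (hdouble (z x) (M x))) (\<lambda>x. hdouble (cnj (z x)) (M x))"
proof -
  note [simp] = carrier_matD[OF assms] assms
  show ?thesis
    by (rule unitarily_equivalentI[OF _ unitary_mat_block_antidiag[of 1 1] unitary_mat_block_antidiag[of 1 1]])
      (simp_all add: hdouble_def mult_four_block_mat[of _ n n _ n _ n _ _ n _ n] mat_adjoint_four_block[of _ n n _ n _ n]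
        mat_adjoint_smult)
qed

text \<open>Block sizes run \<open>a, b, a, b\<close> in the double of a direct sum and
  \<open>a, a, b, b\<close> in the direct sum of the doubles; this permutation leads from positions
  in the first order to positions in the second.\<close>

definition swap_middle :: "nat \<Rightarrow> nat \<Rightarrow> nat \<Rightarrow> nat" where
  "swap_middle a b i = (if i < a then i else if i < a + b then i + a else if i < a + b + a then i - b else i)"

lemma bij_swap_middle: "bij_betw (swap_middle a b) {..<a + b + (a + b)} {..<a + b + (a + b)}"
  by (rule bij_betw_byWitness[where f' = "\<lambda>i. if i < a then i else if i < a + a then i + b else if i < a + a + b then i - a else i"])
    (auto simp: swap_middle_def)

text \<open>The scalar blocks couple an index only with its own copy, so no entry links the two
  summands; sorting the indices by summand therefore splits the double.\<close>

lemma hdouble_block_diag: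
  assumes "\<And>x. A x \<in> carrier_mat a a" "\<And>x. B x \<in> carrier_mat b b"
  shows "unitarily_equivalent (a + b + (a + b))
    (\<lambda>x. hdouble (z x) (four_block_mat (A x) (0\<^sub>m a b) (0\<^sub>m b a) (B x)))
    (\<lambda>x. four_block_mat (hdouble (z x) (A x)) (0\<^sub>m (a + a) (b + b)) (0\<^sub>m (b + b) (a + a)) (hdouble (z x) (B x)))"
  (is "unitarily_equivalent ?n ?L ?R")
proof (rule unitarily_equivalentI[OF _ unitary_reindex_mat[OF bij_swap_middle]
     unitary_mat_adjoint[OF unitary_reindex_mat[OF bij_swap_middle]]])
  note [simp] = carrier_matD[OF assms(1)] carrier_matD[OF assms(2)] assms
  fix x
  show c: "?R x \<in> carrier_mat ?n ?n"
    by (rule carrier_matI) (simp_all add: hdouble_def)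
  show "?L x = reindex_mat ?n (swap_middle a b) * ?R x * mat_adjoint (reindex_mat ?n (swap_middle a b))"
    unfolding reindex_mat_mult[OF c bij_swap_middle]
  proof (rule eq_matI)
    \<comment> \<open>Writing each index as an offset into one of the four blocks lets both sides be
      evaluated at all sixteen block positions.\<close>
    have quarter: "i < a \<or> (\<exists>r<b. i = a + r) \<or> (\<exists>r<a. i = a + b + r) \<or> (\<exists>r<b. i = a + b + a + r)"
      if "i < ?n" for i
    proof -
      consider "i < a" | "a \<le> i" "i < a + b" | "a + b \<le> i" "i < a + b + a" | "a + b + a \<le> i" by linarith
      then show ?thesis
      proof cases
        case 2 then have "i = a + (i - a)" "i - a < b" by auto then show ?thesis by blast
      next
        case 3 then have "i = a + b + (i - (a + b))" "i - (a + b) < a" by auto then show ?thesis by blast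
      next
        case 4 with that have "i = a + b + a + (i - (a + b + a))" "i - (a + b + a) < b" by auto
        then show ?thesis by blast
      qed blast
    qed
    fix i j
    assume "i < dim_row (mat ?n ?n (\<lambda>(i, j). ?R x $$ (swap_middle a b i, swap_middle a b j)))"
      and "j < dim_col (mat ?n ?n (\<lambda>(i, j). ?R x $$ (swap_middle a b i, swap_middle a b j)))"
    then have "i < ?n" "j < ?n" by auto
    from quarter[OF this(1)] quarter[OF this(2)]
    show "?L x $$ (i, j) = mat ?n ?n (\<lambda>(i, j). ?R x $$ (swap_middle a b i, swap_middle a b j)) $$ (i, j)"
      by (elim disjE exE conjE) (simp_all add: hdouble_def swap_middle_def)
  qed (simp_all add: hdouble_def)
qed

subsection \<open>The canonical designs\<close>

lemma diag_block_mat_carrier: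
  "\<forall>A\<in>set As. A \<in> carrier_mat d d \<Longrightarrow> diag_block_mat As \<in> carrier_mat (length As * d) (length As * d)"
  by (induction As) (auto simp: Let_def)

lemma diag_block_mat_Cons_carrier:
  assumes "A \<in> carrier_mat d d" "\<forall>A\<in>set As. A \<in> carrier_mat d d" "l = length As * d"
  shows "diag_block_mat (A # As) = four_block_mat A (0\<^sub>m d l) (0\<^sub>m l d) (diag_block_mat As)"
  using assms diag_block_mat_carrier[OF assms(2)] by (auto simp: Let_def)

lemma unitarily_equivalent_diag_block:
  assumes "list_all2 (unitarily_equivalent d) Fs Gs"
  shows "unitarily_equivalent (length Fs * d) (\<lambda>x. diag_block_mat (map (\<lambda>F. F x) Fs)) (\<lambda>x. diag_block_mat (map (\<lambda>G. G x) Gs))"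
  using assms
proof (induction rule: list_all2_induct)
  case Nil
  show ?case by (rule unitarily_equivalent_refl) simp
next
  case (Cons F Fs G Gs)
  have len: "length Fs = length Gs" using Cons(2) by (rule list_all2_lengthD)
  have c: "F x \<in> carrier_mat d d" "G x \<in> carrier_mat d d" for x
    using Cons(1) by (metis unitarily_equivalentE)+
  have "\<forall>F\<in>set Fs. F x \<in> carrier_mat d d" "\<forall>G\<in>set Gs. G x \<in> carrier_mat d d" for x
    using Cons(2) by (auto simp: list_all2_conv_all_nth in_set_conv_nth) (metis unitarily_equivalentE)+
  then have eq: "diag_block_mat (map (\<lambda>F. F x) (F # Fs))
      = four_block_mat (F x) (0\<^sub>m d (length Fs * d)) (0\<^sub>m (length Fs * d) d) (diag_block_mat (map (\<lambda>F. F x) Fs))"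
    "diag_block_mat (map (\<lambda>F. F x) (G # Gs))
      = four_block_mat (G x) (0\<^sub>m d (length Fs * d)) (0\<^sub>m (length Fs * d) d) (diag_block_mat (map (\<lambda>F. F x) Gs))" for x
    unfolding list.map by (intro diag_block_mat_Cons_carrier; use c len in simp)+
  show ?case
    unfolding eq using unitarily_equivalent_block_diag[OF Cons(1) Cons(3)] by simp
qed

text \<open>Splits off one summand at a time by \<open>hdouble_block_diag\<close>.\<close>

lemma hdouble_diag_block:
  assumes "\<And>F x. F \<in> set Fs \<Longrightarrow> F x \<in> carrier_mat d d"
  shows "unitarily_equivalent (length Fs * (d + d))
    (\<lambda>x. hdouble (z x) (diag_block_mat (map (\<lambda>F. F x) Fs)))
    (\<lambda>x. diag_block_mat (map (\<lambda>F. hdouble (z x) (F x)) Fs))"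
  using assms
proof (induction Fs)
  case Nil
  have "hdouble (z x) (0\<^sub>m 0 0) = 0\<^sub>m 0 0" for x by (rule eq_matI) (simp_all add: hdouble_def)
  then show ?case by (auto intro!: unitarily_equivalent_refl)
next
  case (Cons F Fs)
  let ?l = "length Fs * d"
  have c: "F x \<in> carrier_mat d d" for x using Cons.prems by simp
  have cs: "\<forall>F\<in>set Fs. F x \<in> carrier_mat d d" for x using Cons.prems by simp
  have IH: "unitarily_equivalent (length Fs * (d + d)) (\<lambda>x. hdouble (z x) (diag_block_mat (map (\<lambda>F. F x) Fs)))
    (\<lambda>x. diag_block_mat (map (\<lambda>F. hdouble (z x) (F x)) Fs))"
    using Cons.prems by (intro Cons.IH) simp
  have l: "length Fs * (d + d) = ?l + ?l" by (simp add: algebra_simps)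
  have n: "length (F # Fs) * (d + d) = (d + d) + (?l + ?l)" "(d + d) + (?l + ?l) = d + ?l + (d + ?l)"
    by (simp_all add: algebra_simps)
  have eq1: "diag_block_mat (map (\<lambda>F. F x) (F # Fs))
      = four_block_mat (F x) (0\<^sub>m d ?l) (0\<^sub>m ?l d) (diag_block_mat (map (\<lambda>F. F x) Fs))" for x
    unfolding list.map by (intro diag_block_mat_Cons_carrier; use c cs in simp)
  have eq2: "diag_block_mat (map (\<lambda>F. hdouble (z x) (F x)) (F # Fs))
      = four_block_mat (hdouble (z x) (F x)) (0\<^sub>m (d + d) (?l + ?l)) (0\<^sub>m (?l + ?l) (d + d))
          (diag_block_mat (map (\<lambda>F. hdouble (z x) (F x)) Fs))" for x
    unfolding list.map by (intro diag_block_mat_Cons_carrier; use c cs l in simp)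
  have "diag_block_mat (map (\<lambda>F. F x) Fs) \<in> carrier_mat ?l ?l" for x
    using diag_block_mat_carrier[of "map (\<lambda>F. F x) Fs" d] cs by simp
  from hdouble_block_diag[OF c this, of z]
  have "unitarily_equivalent (d + d + (?l + ?l))
      (\<lambda>x. hdouble (z x) (diag_block_mat (map (\<lambda>F. F x) (F # Fs))))
      (\<lambda>x. four_block_mat (hdouble (z x) (F x)) (0\<^sub>m (d + d) (?l + ?l)) (0\<^sub>m (?l + ?l) (d + d))
        (hdouble (z x) (diag_block_mat (map (\<lambda>F. F x) Fs))))"
    unfolding eq1 n(2) .
  also have "unitarily_equivalent (d + d + (?l + ?l)) \<dots>
      (\<lambda>x. diag_block_mat (map (\<lambda>F. hdouble (z x) (F x)) (F # Fs)))"
    unfolding eq2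
    by (rule unitarily_equivalent_block_diag[OF unitarily_equivalent_refl])
      (use c IH in \<open>simp_all add: l\<close>)
  finally show ?case unfolding n(1) .
qed

lemma Hmat_carrier: "Hmat (Suc j) x \<in> carrier_mat (2 ^ j) (2 ^ j)"
proof (induction j)
  case (Suc j)
  then show ?case by (auto simp: Let_def)
qed simp

lemma Hmat_cong: "(\<And>i. i < 2 * k \<Longrightarrow> x i = y i) \<Longrightarrow> Hmat k x = Hmat k y"
  by (induction k x rule: Hmat.induct) (auto simp: Let_def)

lemma Hminus_carrier: "Hminus (Suc j) x \<in> carrier_mat (2 ^ j) (2 ^ j)"
  by (simp add: Hminus_def Hmat_carrier)

text \<open>\<open>Hmat (Suc j)\<close> depends on the variables with indices below
  \<open>2*j+2\<close>; these are the next two, joined into one complex variable.\<close>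

definition new_var :: "nat \<Rightarrow> (nat \<Rightarrow> real) \<Rightarrow> complex" where
  "new_var j x = Complex (x (2*j+2)) (x (2*j+3))"

lemma Hmat_hdouble: "Hmat (Suc (Suc j)) x = hdouble (new_var j x) (Hmat (Suc j) x)"
proof -
  have "- Complex a (- b) = - cnj (Complex a b)" for a b by (simp add: complex_eq_iff)
  then show ?thesis
    using Hmat_carrier[of j x] by (auto simp: hdouble_def new_var_def Let_def)
qed

text \<open>The sign flip reaches only the imaginary part of the newest complex variable, so it
  conjugates \<open>z\<close> and leaves the inner matrix, which is \<open>Hmat\<close> and not
  \<open>Hminus\<close>, untouched.\<close>

lemma Hminus_hdouble: "Hminus (Suc (Suc j)) x = hdouble (cnj (new_var j x)) (Hmat (Suc j) x)"
proof -
  let ?y = "x(2 * Suc (Suc j) - 1 := - x (2 * Suc (Suc j) - 1))"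
  have "Hmat (Suc j) ?y = Hmat (Suc j) x" by (rule Hmat_cong) auto
  moreover have "new_var j ?y = cnj (new_var j x)"
    by (simp add: new_var_def complex_eq_iff eval_nat_numeral)
  ultimately show ?thesis unfolding Hminus_def Hmat_hdouble by simp
qed

text \<open>Up to equivalence, taking the adjoint of a double conjugates \<open>z\<close>, which
  undoes the conjugation that distinguishes \<open>Hminus\<close> from \<open>Hmat\<close>. For
  \<open>j = 0\<close> the matrix is a single complex number and equality holds.\<close>

lemma Hminus_adjoint: "unitarily_equivalent (2 ^ j) (\<lambda>x. mat_adjoint (Hminus (Suc j) x)) (Hmat (Suc j))"
proof (cases j)
  case 0
  have "mat_adjoint (Hminus (Suc j) x) = Hmat (Suc j) x" for x
    unfolding 0 by (rule eq_matI) (simp_all add: Hminus_def complex_eq_iff)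
  then show ?thesis using Hmat_carrier by (simp add: unitarily_equivalent_refl)
next
  case (Suc i)
  show ?thesis
    using hdouble_adjoint[of "Hmat (Suc i)" "2 ^ i" "\<lambda>x. cnj (new_var i x)"] Hmat_carrier[of i]
    by (simp add: Suc Hminus_hdouble Hmat_hdouble[abs_def] del: Hmat.simps)
       (simp add: mult_2)
qed

text \<open>The minus sign moves from the inner matrix to the new variable:
  \<open>hdouble_swap\<close> conjugates \<open>z\<close> and replaces the inner
  \<open>Hminus\<close> by its adjoint, which is equivalent to \<open>Hmat\<close>.\<close>

lemma hdouble_Hminus:
  "unitarily_equivalent (2 ^ Suc j) (\<lambda>x. hdouble (new_var j x) (Hminus (Suc j) x)) (Hminus (Suc (Suc j)))"
proof -
  have "unitarily_equivalent (2 ^ j + 2 ^ j) (\<lambda>x. hdouble (new_var j x) (Hminus (Suc j) x))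
      (\<lambda>x. hdouble (cnj (new_var j x)) (mat_adjoint (Hminus (Suc j) x)))"
    by (rule hdouble_swap) (rule Hminus_carrier)
  also have "unitarily_equivalent (2 ^ j + 2 ^ j) \<dots> (\<lambda>x. hdouble (cnj (new_var j x)) (Hmat (Suc j) x))"
    by (rule unitarily_equivalent_hdouble) (rule Hminus_adjoint)
  also have "(\<lambda>x. hdouble (cnj (new_var j x)) (Hmat (Suc j) x)) = Hminus (Suc (Suc j))"
    by (rule ext) (simp only: Hminus_hdouble)
  finally show ?thesis by (simp add: mult_2)
qed

definition canonical_design :: "nat \<Rightarrow> nat \<Rightarrow> nat \<Rightarrow> (nat \<Rightarrow> real) \<Rightarrow> complex mat" where
  "canonical_design k n1 n2 x = diag_block_mat (replicate n1 (Hmat k x) @ replicate n2 (Hminus k x))"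

lemma canonical_design_carrier:
  "canonical_design (Suc j) n1 n2 x \<in> carrier_mat ((n1 + n2) * 2 ^ j) ((n1 + n2) * 2 ^ j)"
proof -
  have "\<forall>A\<in>set (replicate n1 (Hmat (Suc j) x) @ replicate n2 (Hminus (Suc j) x)). A \<in> carrier_mat (2 ^ j) (2 ^ j)"
    using Hmat_carrier[of j x] Hminus_carrier[of j x] by auto
  from diag_block_mat_carrier[OF this] show ?thesis by (simp add: canonical_design_def)
qed

text \<open>Doubling distributes over the direct sum and preserves the type of each summand, so both
  multiplicities persist. Classification and uniqueness use this in their induction steps.\<close>

lemma hdouble_canonical_design:
  "unitarily_equivalent ((n1 + n2) * 2 ^ Suc j)
    (\<lambda>x. hdouble (new_var j x) (canonical_design (Suc j) n1 n2 x)) (canonical_design (Suc (Suc j)) n1 n2)"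
proof -
  let ?Fs = "replicate n1 (Hmat (Suc j)) @ replicate n2 (Hminus (Suc j))"
  let ?Gs = "replicate n1 (Hmat (Suc (Suc j))) @ replicate n2 (Hminus (Suc (Suc j)))"
  let ?Ds = "map (\<lambda>F x. hdouble (new_var j x) (F x)) ?Fs"
  have "unitarily_equivalent (length ?Fs * (2 ^ j + 2 ^ j))
      (\<lambda>x. hdouble (new_var j x) (diag_block_mat (map (\<lambda>F. F x) ?Fs)))
      (\<lambda>x. diag_block_mat (map (\<lambda>F. hdouble (new_var j x) (F x)) ?Fs))"
    by (rule hdouble_diag_block) (auto simp: Hmat_carrier Hminus_carrier)
  also have "(\<lambda>x. diag_block_mat (map (\<lambda>F. hdouble (new_var j x) (F x)) ?Fs))
      = (\<lambda>x. diag_block_mat (map (\<lambda>F. F x) ?Ds))"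
    by (simp add: map_replicate_const)
  also have "unitarily_equivalent (length ?Fs * (2 ^ j + 2 ^ j)) \<dots> (\<lambda>x. diag_block_mat (map (\<lambda>F. F x) ?Gs))"
  proof -
    have "list_all2 (unitarily_equivalent (2 ^ Suc j)) ?Ds ?Gs"
      unfolding map_append map_replicate
    proof (rule list_all2_appendI)
      have "unitarily_equivalent (2 ^ Suc j) (\<lambda>x. hdouble (new_var j x) (Hmat (Suc j) x)) (Hmat (Suc (Suc j)))"
        unfolding Hmat_hdouble[symmetric] by (rule unitarily_equivalent_refl) (rule Hmat_carrier)
      then show "list_all2 (unitarily_equivalent (2 ^ Suc j))
          (replicate n1 (\<lambda>x. hdouble (new_var j x) (Hmat (Suc j) x))) (replicate n1 (Hmat (Suc (Suc j))))"
        by (auto simp add: list_all2_conv_all_nth simp del: Hmat.simps)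
      show "list_all2 (unitarily_equivalent (2 ^ Suc j))
          (replicate n2 (\<lambda>x. hdouble (new_var j x) (Hminus (Suc j) x))) (replicate n2 (Hminus (Suc (Suc j))))"
        using hdouble_Hminus[of j] by (auto simp add: list_all2_conv_all_nth simp del: Hmat.simps)
    qed
    from unitarily_equivalent_diag_block[OF this] show ?thesis by (simp only: length_map power_Suc mult_2)
  qed
  finally show ?thesis
    by (simp add: canonical_design_def[abs_def] mult_2 del: Hmat.simps)
qed

subsection \<open>Uniqueness of the multiplicities\<close>

lemma hdouble_zero: "hdouble z (0\<^sub>m n n) = four_block_mat (0\<^sub>m n n) (z \<cdot>\<^sub>m 1\<^sub>m n) ((- cnj z) \<cdot>\<^sub>m 1\<^sub>m n) (0\<^sub>m n n)"
  by (simp add: hdouble_def)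

text \<open>Evaluating at \<open>z = 1\<close> and at \<open>z = \<i>\<close> shows that the right factor commutes with
  \<open>diag(-\<i>I, \<i>I)\<close> and that the left factor is determined by it, so that both are block diagonal.\<close>

lemma unitarily_equivalent_hdoubleD:
  assumes A: "\<And>x. A x \<in> carrier_mat n n" and B: "\<And>x. B x \<in> carrier_mat n n"
    and eqv: "unitarily_equivalent (n + n) (\<lambda>x. hdouble (z x) (A x)) (\<lambda>x. hdouble (z x) (B x))"
    and p: "A p = 0\<^sub>m n n" "B p = 0\<^sub>m n n" "z p = 1"
    and q: "A q = 0\<^sub>m n n" "B q = 0\<^sub>m n n" "z q = \<i>"
  shows "unitarily_equivalent n A B"
proof -
  note [simp] = A B carrier_matD[OF A] carrier_matD[OF B]
  note mult = mult_four_block_mat[of _ n n _ n _ n _ _ n _ n]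
  note adj = mat_adjoint_four_block[of _ n n _ n _ n]
  obtain U V where UV: "unitary_mat (n + n) U" "unitary_mat (n + n) V"
    and eq: "\<And>x. hdouble (z x) (A x) = U * hdouble (z x) (B x) * V"
    using unitarily_equivalentE[OF eqv] by metis
  note U = unitary_matD[OF UV(1)] and V = unitary_matD[OF UV(2)]
  define J where "J = hdouble 1 (0\<^sub>m n n)"
  define K where "K = hdouble \<i> (0\<^sub>m n n)"
  have JK: "J \<in> carrier_mat (n + n) (n + n)" "K \<in> carrier_mat (n + n) (n + n)"
    by (simp_all add: J_def K_def)
  note [simp] = carrier_matD[OF JK(1)] carrier_matD[OF JK(2)]
  have uJ: "unitary_mat (n + n) J"
    using unitary_mat_block_antidiag[of 1 "- 1" n] by (simp add: J_def hdouble_zero)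
  have J: "J = U * J * V" and K: "K = U * K * V"
    using eq[of p] eq[of q] by (simp_all add: J_def K_def p q)
  \<comment> \<open>Both \<open>J\<close> and \<open>K\<close> satisfy \<open>X = U X V\<close>; in
    \<open>J\<^sup>H K\<close> the factor \<open>U\<close> cancels, which leaves
    \<open>E = V\<^sup>H E V\<close>.\<close>
  define E where "E = mat_adjoint J * K"
  have E: "E = four_block_mat ((- \<i>) \<cdot>\<^sub>m 1\<^sub>m n) (0\<^sub>m n n) (0\<^sub>m n n) (\<i> \<cdot>\<^sub>m 1\<^sub>m n)"
    by (simp add: E_def J_def K_def hdouble_zero mult adj mat_adjoint_smult)
  have "J * mat_adjoint V = U * J * V * mat_adjoint V" using J by simp
  then have JV: "J * mat_adjoint V = U * J"
    using U V by (simp add: mult_mat_assoc)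
  then have UJ: "U = J * mat_adjoint V * mat_adjoint J"
    using U V unitary_matD[OF uJ] by (simp add: mult_mat_assoc)
  have "mat_adjoint J * K = mat_adjoint J * (U * K * V)" using K by simp
  also have "\<dots> = mat_adjoint V * (E * V)"
    using U V unitary_matD[OF uJ]
    by (simp add: UJ E_def mult_mat_assoc unitary_mat_cancel[OF uJ])
  finally have "V * E = V * (mat_adjoint V * (E * V))" by (simp add: E_def)
  then have comm: "V * E = E * V"
    using V by (simp add: unitary_mat_cancel[OF UV(2)] E)
  obtain V1 V2 V3 V4 where sb: "split_block V n n = (V1, V2, V3, V4)" by (cases "split_block V n n") auto
  note sb = split_block[OF sb V(3,4)]
  note [simp] = sb(1-4) carrier_matD[OF sb(1)] carrier_matD[OF sb(2)] carrier_matD[OF sb(3)] carrier_matD[OF sb(4)]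
  \<comment> \<open>The two products scale the off-diagonal blocks of \<open>V\<close> by the
    opposite numbers \<open>\<i>\<close> and \<open>- \<i>\<close>, so these blocks vanish.\<close>
  have comm': "four_block_mat ((- \<i>) \<cdot>\<^sub>m V1) (\<i> \<cdot>\<^sub>m V2) ((- \<i>) \<cdot>\<^sub>m V3) (\<i> \<cdot>\<^sub>m V4)
    = four_block_mat ((- \<i>) \<cdot>\<^sub>m V1) ((- \<i>) \<cdot>\<^sub>m V2) (\<i> \<cdot>\<^sub>m V3) (\<i> \<cdot>\<^sub>m V4)"
    using comm unfolding sb(5) E by (simp add: mult)
  have zero: "X = 0\<^sub>m n n" if "X \<in> carrier_mat n n" "\<i> \<cdot>\<^sub>m X = (- \<i>) \<cdot>\<^sub>m X" for X
  proof (rule eq_matI)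
    fix i j assume "i < dim_row (0\<^sub>m n n :: complex mat)" "j < dim_col (0\<^sub>m n n :: complex mat)"
    then have "(\<i> \<cdot>\<^sub>m X) $$ (i, j) = \<i> * X $$ (i, j)" "((- \<i>) \<cdot>\<^sub>m X) $$ (i, j) = - \<i> * X $$ (i, j)"
        "0\<^sub>m n n $$ (i, j) = (0 :: complex)"
      using that(1) by auto
    then show "X $$ (i, j) = 0\<^sub>m n n $$ (i, j)" using that(2) by simp
  qed (use that in auto)
  have V23: "V2 = 0\<^sub>m n n" "V3 = 0\<^sub>m n n"
    using four_block_mat_eqD[OF comm', of n n n n] by (auto intro!: zero)
  have Vb: "V = four_block_mat V1 (0\<^sub>m n n) (0\<^sub>m n n) V4"
    using sb(5) V23 by simp
  have "four_block_mat (mat_adjoint V1 * V1) (0\<^sub>m n n) (0\<^sub>m n n) (mat_adjoint V4 * V4)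
      = four_block_mat (1\<^sub>m n) (0\<^sub>m n n) (0\<^sub>m n n) (1\<^sub>m n)"
    using V(5) unfolding Vb by (simp add: adj mult four_block_one_mat)
  from four_block_mat_eqD(1,4)[OF this, of n n n n]
  have u: "unitary_mat n V1" "unitary_mat n V4"
    by (simp_all add: unitary_mat_leftI mult_carrier_mat[of _ n n _ n])
  \<comment> \<open>Conjugation by \<open>J\<close> exchanges the two diagonal blocks of
    \<open>V\<^sup>H\<close>.\<close>
  have Ub: "U = four_block_mat (mat_adjoint V4) (0\<^sub>m n n) (0\<^sub>m n n) (mat_adjoint V1)"
    unfolding UJ Vb J_def by (simp add: hdouble_zero mult adj mat_adjoint_smult)
  show ?thesis
  proof (rule unitarily_equivalentI[OF B unitary_mat_adjoint[OF u(2)] u(1)])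
    fix x
    have "U * hdouble (z x) (B x) * V = four_block_mat (mat_adjoint V4 * B x * V1) (z x \<cdot>\<^sub>m 1\<^sub>m n)
       ((- cnj (z x)) \<cdot>\<^sub>m 1\<^sub>m n) (mat_adjoint V1 * mat_adjoint (B x) * V4)"
      unfolding Ub Vb hdouble_def using unitary_matD[OF u(1)] unitary_matD[OF u(2)]
      by (simp add: mult mult_carrier_mat[of _ n n _ n])
    then have "four_block_mat (A x) (z x \<cdot>\<^sub>m 1\<^sub>m n) ((- cnj (z x)) \<cdot>\<^sub>m 1\<^sub>m n) (mat_adjoint (A x))
       = four_block_mat (mat_adjoint V4 * B x * V1) (z x \<cdot>\<^sub>m 1\<^sub>m n)
       ((- cnj (z x)) \<cdot>\<^sub>m 1\<^sub>m n) (mat_adjoint V1 * mat_adjoint (B x) * V4)"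
      using eq[of x] by (simp add: hdouble_def)
    from four_block_mat_eqD(1)[OF this, of n n n n]
    show "A x = mat_adjoint V4 * B x * V1" by (simp add: mult_carrier_mat[of _ n n _ n])
  qed
qed

lemma Hmat_zero: "(\<And>i. i < 2 * Suc j \<Longrightarrow> x i = 0) \<Longrightarrow> Hmat (Suc j) x = 0\<^sub>m (2 ^ j) (2 ^ j)"
proof (induction j)
  case 0
  then show ?case by (intro eq_matI) (auto simp: complex_eq_iff)
next
  case (Suc j)
  have "Hmat (Suc j) x = 0\<^sub>m (2 ^ j) (2 ^ j)" using Suc by simp
  moreover have "new_var j x = 0" using Suc.prems by (simp add: new_var_def complex_eq_iff)
  moreover have "hdouble 0 (0\<^sub>m (2 ^ j) (2 ^ j)) = 0\<^sub>m (2 ^ Suc j) (2 ^ Suc j)"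
    by (rule eq_matI) (auto simp: hdouble_zero)
  ultimately show ?case by (simp only: Hmat_hdouble)
qed

text \<open>Supplies the points at which the inner design vanishes, as
  \<open>unitarily_equivalent_hdoubleD\<close> demands.\<close>

lemma canonical_design_zero:
  assumes "\<And>i. i < 2 * Suc j \<Longrightarrow> x i = 0"
  shows "canonical_design (Suc j) n1 n2 x = 0\<^sub>m ((n1 + n2) * 2 ^ j) ((n1 + n2) * 2 ^ j)"
proof -
  have "Hminus (Suc j) x = 0\<^sub>m (2 ^ j) (2 ^ j)" unfolding Hminus_def using assms by (intro Hmat_zero) auto
  then have *: "\<forall>A \<in> set (replicate n1 (Hmat (Suc j) x) @ replicate n2 (Hminus (Suc j) x)). A = 0\<^sub>m (2 ^ j) (2 ^ j)"
    using Hmat_zero[OF assms] by auto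
  have "diag_block_mat As = 0\<^sub>m (length As * d) (length As * d)"
    if "\<forall>A\<in>set As. A = 0\<^sub>m d d" for As and d :: nat
    using that by (induction As) (auto simp: Let_def)
  from this[OF *] show ?thesis by (simp add: canonical_design_def del: Hmat.simps)
qed

lemma canonical_design_1:
  "canonical_design 1 n1 n2 x = mat (n1 + n2) (n1 + n2)
     (\<lambda>(i, j). if i = j then if i < n1 then Complex (x 0) (x 1) else Complex (x 0) (- x 1) else 0)"
proof -
  have "diag_block_mat (replicate n2 (mat 1 1 (\<lambda>_. b))) = mat n2 n2 (\<lambda>(i, j). if i = j then b else 0)"
    for b :: complex
    by (induction n2) (auto simp: Let_def intro!: eq_matI)
  moreover have "diag_block_mat (replicate n1 (mat 1 1 (\<lambda>_. a)) @ replicate n2 (mat 1 1 (\<lambda>_. b)))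
    = mat (n1 + n2) (n1 + n2) (\<lambda>(i, j). if i = j then if i < n1 then a else b else 0)"
    if "diag_block_mat (replicate n2 (mat 1 1 (\<lambda>_. b))) = mat n2 n2 (\<lambda>(i, j). if i = j then b else 0)"
    for a b :: complex
    using that by (induction n1) (auto simp: Let_def intro!: eq_matI)
  ultimately show ?thesis by (simp add: canonical_design_def Hminus_def cong: if_cong)
qed

lemma canonical_design_unique:
  assumes "unitarily_equivalent ((n1 + n2) * 2 ^ j) (canonical_design (Suc j) n1 n2) (canonical_design (Suc j) m1 m2)"
    and "n1 + n2 = m1 + m2"
  shows "n1 = m1"
  using assms
proof (induction j)
  case 0
  define n where "n = n1 + n2"
  let ?D = "\<lambda>n1 c :: complex. mat n n (\<lambda>(i, j). if i = j then if i < n1 then c else - c else 0)"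
  obtain U V where UV: "unitary_mat n U" "unitary_mat n V"
    and eq: "\<And>x. canonical_design 1 n1 n2 x = U * canonical_design 1 m1 m2 x * V"
    using 0 unfolding n_def by (auto elim!: unitarily_equivalentE)
  note [simp] = unitary_matD[OF UV(1)] unitary_matD[OF UV(2)]
  \<comment> \<open>Both designs are the identity at the first unit vector, hence \<open>V\<close>
    is inverse to \<open>U\<close> and the equivalence is a similarity.\<close>
  have "canonical_design 1 a b (\<lambda>i. if i = 0 then 1 else 0) = 1\<^sub>m n" if "a + b = n" for a b
    unfolding canonical_design_1 that by (rule eq_matI) (auto simp: complex_eq_iff)
  then have "U * V = 1\<^sub>m n" using eq[of "\<lambda>i. if i = 0 then 1 else 0"] 0(2) by (simp add: n_def)
  then have VU: "V * U = 1\<^sub>m n" using mat_mult_left_right_inverse[of U n V] by simp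
  \<comment> \<open>At the second unit vector the diagonal consists of \<open>a\<close> entries
    \<open>\<i>\<close> and \<open>b\<close> entries \<open>- \<i>\<close>, so for fixed
    \<open>n\<close> the trace determines \<open>a\<close>.\<close>
  have 1: "canonical_design 1 a b (\<lambda>i. if i = 1 then 1 else 0) = ?D a \<i>" if "a + b = n" for a b
    unfolding canonical_design_1 that by (rule eq_matI) (auto simp: complex_eq_iff)
  have D: "?D n1 \<i> = U * ?D m1 \<i> * V" using eq[of "\<lambda>i. if i = 1 then 1 else 0"] 0(2) by (simp only: 1 n_def)
  have "(\<Sum>i<n. ?D n1 \<i> $$ (i, i)) = (\<Sum>i<n. (V * (U * ?D m1 \<i>)) $$ (i, i))"
    unfolding D by (rule sum_diag_mult_comm) (auto intro: mult_carrier_mat)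
  also have "V * (U * ?D m1 \<i>) = ?D m1 \<i>" using VU by (simp add: mult_mat_assoc[symmetric])
  finally have tr: "(\<Sum>i<n. ?D n1 \<i> $$ (i, i)) = (\<Sum>i<n. ?D m1 \<i> $$ (i, i))" .
  have sum: "(\<Sum>i<n. ?D a \<i> $$ (i, i)) = \<i> * (2 * of_nat a - of_nat n)" if "a \<le> n" for a
  proof -
    have "(\<Sum>i<n. ?D a \<i> $$ (i, i)) = (\<Sum>i<n. if i < a then \<i> else - \<i>)"
      by (rule sum.cong) auto
    also have "\<dots> = (\<Sum>i<a. \<i>) + (\<Sum>i\<in>{a..<n}. - \<i>)"
      unfolding lessThan_atLeast0 sum.atLeastLessThan_concat[OF le0 that, symmetric] by simp
    finally show ?thesis using that by (simp add: of_nat_diff algebra_simps)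
  qed
  have "(of_nat n1 :: complex) = of_nat m1"
  proof -
    have "n1 \<le> n" "m1 \<le> n" using 0(2) by (simp_all add: n_def)
    with tr show ?thesis by (simp only: sum) simp
  qed
  then show ?case by simp
next
  case (Suc j)
  let ?n = "(n1 + n2) * 2 ^ j"
  have n: "(n1 + n2) * 2 ^ Suc j = ?n + ?n" by simp
  have "unitarily_equivalent (?n + ?n) (\<lambda>x. hdouble (new_var j x) (canonical_design (Suc j) n1 n2 x))
      (canonical_design (Suc (Suc j)) n1 n2)"
    using hdouble_canonical_design[of n1 n2 j] unfolding n .
  also have "unitarily_equivalent (?n + ?n) \<dots> (canonical_design (Suc (Suc j)) m1 m2)"
    using Suc.prems(1) unfolding n .
  also have "unitarily_equivalent (?n + ?n) \<dots> (\<lambda>x. hdouble (new_var j x) (canonical_design (Suc j) m1 m2 x))"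
    using hdouble_canonical_design[of m1 m2 j, THEN unitarily_equivalent_sym] unfolding Suc.prems(2)[symmetric] n .
  finally have eqv: "unitarily_equivalent (?n + ?n) (\<lambda>x. hdouble (new_var j x) (canonical_design (Suc j) n1 n2 x))
      (\<lambda>x. hdouble (new_var j x) (canonical_design (Suc j) m1 m2 x))" .
  \<comment> \<open>The unit vectors of the two new variables: all older variables are 0, and
    \<open>new_var\<close> takes the values \<open>1\<close> and \<open>\<i>\<close>.\<close>
  let ?p = "\<lambda>i. if i = 2 * j + 2 then 1 else 0 :: real" and ?q = "\<lambda>i. if i = 2 * j + 3 then 1 else 0 :: real"
  have zero: "canonical_design (Suc j) n1 n2 x = 0\<^sub>m ?n ?n" "canonical_design (Suc j) m1 m2 x = 0\<^sub>m ?n ?n"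
    if "\<And>i. i < 2 * Suc j \<Longrightarrow> x i = 0" for x
    using canonical_design_zero[of j x n1 n2, OF that] canonical_design_zero[of j x m1 m2, OF that] Suc.prems(2)
    by (simp_all only:)
  have "unitarily_equivalent ?n (canonical_design (Suc j) n1 n2) (canonical_design (Suc j) m1 m2)"
  proof (rule unitarily_equivalent_hdoubleD[OF _ _ eqv])
    show "canonical_design (Suc j) n1 n2 x \<in> carrier_mat ?n ?n" for x by (rule canonical_design_carrier)
    show "canonical_design (Suc j) m1 m2 x \<in> carrier_mat ?n ?n" for x
      unfolding Suc.prems(2) by (rule canonical_design_carrier)
    show "new_var j ?p = 1" "new_var j ?q = \<i>" by (simp_all add: new_var_def complex_eq_iff)
  qed (rule zero, simp)+
  then show ?case using Suc by blast
qed

subsection \<open>Diagonalisation of Hermitian involutions\<close>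

text \<open>Complete \<open>v\<close> to a basis, orthogonalise by Gram-Schmidt and normalise the
  columns.\<close>

lemma unitary_mat_extending_vec:
  fixes v :: "complex vec"
  assumes v: "v \<in> carrier_vec n" "v \<noteq> 0\<^sub>v n" and n: "0 < n"
  obtains W c where "unitary_mat n W" "col W 0 = c \<cdot>\<^sub>v v"
proof -
  interpret cof_vec_space n "TYPE(complex)" .
  define us where "us = gram_schmidt n (basis_completion v)"
  note bc = basis_completion[OF v]
  note gs = gram_schmidt_result[OF bc(2,4,5) us_def]
  have len: "length us = n" using gs(4) bc(6) by simp
  \<comment> \<open>Gram-Schmidt keeps the first vector, so column 0 stays a multiple of
    \<open>v\<close>.\<close>
  obtain vs where "basis_completion v = v # vs" by (simp add: basis_completion_def Let_def)
  then have "hd us = v" using v(1) by (simp add: us_def)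
  then have hd: "us ! 0 = v" using len n by (cases us) auto
  have uc: "us ! i \<in> carrier_vec n" if "i < n" for i using gs(3) that len by auto
  \<comment> \<open>Gram-Schmidt delivers orthogonal nonzero vectors of arbitrary length;
    \<open>N i\<close> is the norm of the one with index \<open>i\<close>.\<close>
  define N where "N i = complex_of_real (sqrt (Re (us ! i \<bullet>c us ! i)))" for i
  define W where "W = mat n n (\<lambda>(i, j). us ! j $ i / N j)"
  have N: "cnj (N i) * N i = us ! i \<bullet>c us ! i" "N i \<noteq> 0" if "i < n" for i
  proof -
    let ?z = "us ! i \<bullet>c us ! i"
    have "0 \<le> ?z" by (rule conjugate_square_ge_0_vec)
    then have r: "0 \<le> Re ?z" "?z = complex_of_real (Re ?z)" by (auto simp: less_eq_complex_def complex_eq_iff)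
    have "?z \<noteq> 0" using corthogonalD[OF gs(2), of i i] that len by simp
    with r have "Re ?z \<noteq> 0" by (metis of_real_0)
    with r(1) show "N i \<noteq> 0" by (simp add: N_def)
    have "cnj (N i) * N i = complex_of_real (sqrt (Re ?z) * sqrt (Re ?z))"
      by (simp only: N_def complex_cnj_complex_of_real of_real_mult)
    also have "sqrt (Re ?z) * sqrt (Re ?z) = Re ?z" using r(1) by simp
    finally show "cnj (N i) * N i = ?z" using r(2) by simp
  qed
  have "mat_adjoint W * W = 1\<^sub>m n"
  proof (rule eq_matI)
    fix i j assume "i < dim_row (1\<^sub>m n :: complex mat)" "j < dim_col (1\<^sub>m n :: complex mat)"
    then have ij: "i < n" "j < n" by auto
    have "(mat_adjoint W * W) $$ (i, j) = (\<Sum>k\<in>{0..<n}. cnj (us ! i $ k / N i) * (us ! j $ k / N j))"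
      using ij by (simp add: W_def scalar_prod_def)
    also have "\<dots> = (\<Sum>k\<in>{0..<n}. us ! j $ k * cnj (us ! i $ k)) / (cnj (N i) * N j)"
      by (simp add: sum_divide_distrib mult.commute)
    also have "(\<Sum>k\<in>{0..<n}. us ! j $ k * cnj (us ! i $ k)) = us ! j \<bullet>c us ! i"
      using uc[OF ij(1)] by (auto simp: scalar_prod_def)
    also have "us ! j \<bullet>c us ! i / (cnj (N i) * N j) = (if i = j then 1 else 0)"
      using N[OF ij(1)] N[OF ij(2)] corthogonalD[OF gs(2), of j i] ij len by auto
    finally show "(mat_adjoint W * W) $$ (i, j) = 1\<^sub>m n $$ (i, j)" using ij by simp
  qed (simp_all add: W_def)
  then have "unitary_mat n W" by (intro unitary_mat_leftI) (simp_all add: W_def)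
  moreover have "col W 0 = (1 / N 0) \<cdot>\<^sub>v v"
    by (rule eq_vecI) (use n v hd in \<open>auto simp: W_def\<close>)
  ultimately show thesis using that by blast
qed

text \<open>Normal form of a Hermitian involution for \<open>c = - 1\<close>, and of a
  skew-Hermitian unitary matrix for \<open>c = \<i>\<close> or \<open>c = - \<i>\<close>.\<close>

definition sign_diag_mat :: "nat \<Rightarrow> nat \<Rightarrow> complex \<Rightarrow> complex mat" where
  "sign_diag_mat n p c = mat n n (\<lambda>(i, j). if i = j then if i < p then c else - c else 0)"

text \<open>Deflation. Unless \<open>S\<close> is the identity, \<open>1 - S\<close> has a nonzero
  column, and it is an eigenvector for \<open>- 1\<close> because
  \<open>S (1 - S) = - (1 - S)\<close>. Taking it as the first vector of an orthonormal basis splits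
  \<open>S\<close> into \<open>- 1\<close> and a smaller Hermitian involution. As eigenvalues
  \<open>- 1\<close> are removed first, the diagonal comes out sorted.\<close>

lemma hermitian_involution_diag:
  assumes "S \<in> carrier_mat n n" "mat_adjoint S = S" "S * S = 1\<^sub>m n"
  shows "\<exists>W p. unitary_mat n W \<and> p \<le> n \<and> S = W * sign_diag_mat n p (- 1) * mat_adjoint W"
  using assms
proof (induction n arbitrary: S)
  case 0
  then show ?case
    by (intro exI[of _ "1\<^sub>m 0"] exI[of _ 0] conjI unitary_mat_one) (auto intro!: eq_matI)
next
  case (Suc n)
  note S = Suc.prems
  note One_nat_def [simp del]
  note [simp] = carrier_matD[OF S(1)]
  show ?case
  proof (cases "S = 1\<^sub>m (Suc n)")
    case True
    \<comment> \<open>With \<open>p = 0\<close> every diagonal entry is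
      \<open>- (- 1)\<close>.\<close>
    then show ?thesis
      by (intro exI[of _ "1\<^sub>m (Suc n)"] exI[of _ 0] conjI unitary_mat_one)
        (auto intro!: eq_matI simp: sign_diag_mat_def)
  next
    case False
    define M where "M = 1\<^sub>m (Suc n) - S"
    have M: "M \<in> carrier_mat (Suc n) (Suc n)" using S(1) by (simp add: M_def minus_carrier_mat)
    note [simp] = carrier_matD[OF M]
    have SM: "S * M = (- 1) \<cdot>\<^sub>m M"
    proof -
      have "S * M = S * 1\<^sub>m (Suc n) - S * S"
        unfolding M_def by (rule mult_minus_distrib_mat[OF S(1) _ S(1)]) simp
      then show ?thesis using S by (auto intro!: eq_matI simp: M_def)
    qed
    obtain j where j: "j < Suc n" "col M j \<noteq> 0\<^sub>v (Suc n)"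
    proof -
      obtain i j where "i < Suc n" "j < Suc n" "S $$ (i, j) \<noteq> 1\<^sub>m (Suc n) $$ (i, j)"
        using False S(1) by (metis carrier_matD eq_matI index_one_mat(2,3))
      then have "col M j $ i \<noteq> 0" using S(1) by (simp add: M_def)
      with \<open>i < Suc n\<close> \<open>j < Suc n\<close> show thesis using that by fastforce
    qed
    obtain W c where W: "unitary_mat (Suc n) W" and c: "col W 0 = c \<cdot>\<^sub>v col M j"
      using unitary_mat_extending_vec[OF _ j(2)] M j by (metis col_carrier_vec zero_less_Suc carrier_matD(2))
    note [simp] = unitary_matD[OF W]
    define T where "T = mat_adjoint W * (S * W)"
    have T: "T \<in> carrier_mat (1 + n) (1 + n)"
      unfolding T_def by (rule carrier_matI) simp_all
    have adjT: "mat_adjoint T = T"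
      by (simp add: T_def mat_adjoint_mult[of _ "Suc n" "Suc n" _ "Suc n"] mult_carrier_mat[of _ "Suc n" "Suc n" _ "Suc n"]
          S mult_mat_assoc)
    have TT: "T * T = 1\<^sub>m (1 + n)"
      using S(3) by (simp add: T_def mult_mat_assoc unitary_mat_cancel[OF W])
         (simp add: mult_mat_assoc[symmetric] One_nat_def)
    have "S * W = W * (mat_adjoint W * (S * W))" by (simp add: unitary_mat_cancel[OF W])
    then have STW: "S = W * T * mat_adjoint W"
      by (simp add: T_def mult_mat_assoc unitary_mat_cancel[OF W])
    have colSW: "col (S * W) 0 = - col W 0"
    proof -
      have "col (S * W) 0 = S *\<^sub>v (c \<cdot>\<^sub>v col M j)" using c by (simp add: col_mult2[of _ "Suc n" "Suc n" _ "Suc n"] S(1))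
      also have "\<dots> = c \<cdot>\<^sub>v (S *\<^sub>v col M j)"
        by (rule mult_mat_vec[OF S(1) carrier_vecI]) simp
      also have "\<dots> = - col W 0"
        unfolding col_mult2[OF S(1) M j(1), symmetric] SM c using j by (auto intro!: eq_vecI)
      finally show ?thesis .
    qed
    \<comment> \<open>In the new basis the first basis vector is an eigenvector for
      \<open>- 1\<close>.\<close>
    have T0: "T $$ (i, 0) = - (if i = 0 then 1 else 0)" if "i < Suc n" for i
    proof -
      have "T $$ (i, 0) = row (mat_adjoint W) i \<bullet> - col W 0"
        using that colSW by (simp add: T_def)
      also have "\<dots> = - (row (mat_adjoint W) i \<bullet> col W 0)"
        by (rule scalar_prod_uminus_right) simp
      also have "row (mat_adjoint W) i \<bullet> col W 0 = (mat_adjoint W * W) $$ (i, 0)"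
        using that by (simp del: unitary_matD(5)[OF W])
      finally show ?thesis using that by simp
    qed
    obtain T1 T2 T3 T4 where sb: "split_block T 1 1 = (T1, T2, T3, T4)" by (cases "split_block T 1 1") auto
    note sb = split_block[OF sb carrier_matD[OF T]]
    note [simp] = sb(1-4) carrier_matD[OF sb(1)] carrier_matD[OF sb(2)] carrier_matD[OF sb(3)] carrier_matD[OF sb(4)]
    have T1: "T1 = (- 1) \<cdot>\<^sub>m 1\<^sub>m 1"
      using T0[of 0] by (intro eq_matI) (simp_all add: sb(5))
    have T3: "T3 = 0\<^sub>m n 1"
    proof (rule eq_matI)
      fix i k assume "i < dim_row (0\<^sub>m n 1 :: complex mat)" "k < dim_col (0\<^sub>m n 1 :: complex mat)"
      then show "T3 $$ (i, k) = 0\<^sub>m n 1 $$ (i, k)"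
        using T0[of "Suc i"] by (simp add: sb(5))
    qed simp_all
    have "four_block_mat (mat_adjoint T1) (mat_adjoint T3) (mat_adjoint T2) (mat_adjoint T4) = four_block_mat T1 T2 T3 T4"
      using adjT unfolding sb(5) by (simp add: mat_adjoint_four_block[of _ 1 1 _ n _ n])
    \<comment> \<open>Self-adjointness carries the vanishing of \<open>T3\<close> over to
      \<open>T2\<close>.\<close>
    from four_block_mat_eqD(2,4)[OF this, of 1 1 n n]
    have T2: "T2 = 0\<^sub>m 1 n" and adj4: "mat_adjoint T4 = T4" by (simp_all add: T3)
    have "four_block_mat (1\<^sub>m 1) (0\<^sub>m 1 n) (0\<^sub>m n 1) (T4 * T4) = four_block_mat (1\<^sub>m 1) (0\<^sub>m 1 n) (0\<^sub>m n 1) (1\<^sub>m n)"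
      using TT unfolding sb(5) T1 T2 T3 by (simp add: mult_four_block_mat[of _ 1 1 _ n _ n _ _ 1 _ n] four_block_one_mat)
    from four_block_mat_eqD(4)[OF this, of 1 1 n n]
    have "T4 * T4 = 1\<^sub>m n" by (simp add: mult_carrier_mat[of _ n n _ n])
    from Suc.IH[OF sb(4) adj4 this] obtain W' p where W': "unitary_mat n W'" and p: "p \<le> n"
      and T4: "T4 = W' * sign_diag_mat n p (- 1) * mat_adjoint W'" by blast
    note [simp] = unitary_matD[OF W']
    define X where "X = four_block_mat (1\<^sub>m 1) (0\<^sub>m 1 n) (0\<^sub>m n 1) W'"
    have X: "unitary_mat (1 + n) X" unfolding X_def by (rule unitary_mat_block_diag[OF unitary_mat_one W'])
    note [simp] = unitary_matD[OF X]
    \<comment> \<open>Prepending one more \<open>- 1\<close> keeps the diagonal sorted and raises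
      \<open>p\<close> by one.\<close>
    have D: "sign_diag_mat (1 + n) (Suc p) (- 1) = four_block_mat ((- 1) \<cdot>\<^sub>m 1\<^sub>m 1) (0\<^sub>m 1 n) (0\<^sub>m n 1) (sign_diag_mat n p (- 1))"
      by (rule eq_matI) (auto simp: sign_diag_mat_def)
    have c: "sign_diag_mat n p (- 1) \<in> carrier_mat n n" by (simp add: sign_diag_mat_def)
    note [simp] = c carrier_matD[OF c]
    have TX: "T = X * sign_diag_mat (1 + n) (Suc p) (- 1) * mat_adjoint X"
      unfolding sb(5) T1 T2 T3 T4 D X_def
      by (simp add: mat_adjoint_four_block[of _ 1 1 _ n _ n] mult_four_block_mat[of _ 1 1 _ n _ n _ _ 1 _ n] mult_carrier_mat[of _ n n _ n]
        )
    have n1: "1 + n = Suc n" by simp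
    have X': "unitary_mat (Suc n) X" using X unfolding n1 .
    have "mat_adjoint (W * X) = mat_adjoint X * mat_adjoint W"
      by (rule mat_adjoint_mult[OF unitary_matD(1)[OF W] unitary_matD(1)[OF X']])
    then have "S = (W * X) * sign_diag_mat (Suc n) (Suc p) (- 1) * mat_adjoint (W * X)"
      unfolding STW TX n1 using unitary_matD[OF X'] by (simp add: mult_mat_assoc sign_diag_mat_def)
    moreover have "unitary_mat (Suc n) (W * X)" using unitary_mat_mult[OF W X'] .
    ultimately show ?thesis using p by (intro exI[of _ "W * X"] exI[of _ "Suc p"]) simp
  qed
qed

subsection \<open>Normalising a design\<close>

definition coeff_mat :: "nat \<Rightarrow> (nat \<Rightarrow> nat \<Rightarrow> nat \<Rightarrow> complex) \<Rightarrow> nat \<Rightarrow> complex mat" where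
  "coeff_mat n C i = mat n n (\<lambda>(r, s). C i r s)"

lemma coeff_mat_carrier [simp]: "coeff_mat n C i \<in> carrier_mat n n"
  "dim_row (coeff_mat n C i) = n" "dim_col (coeff_mat n C i) = n"
  by (simp_all add: coeff_mat_def)

lemma design_mat_carrier [simp]: "design_mat p n m C x \<in> carrier_mat p n"
  "dim_row (design_mat p n m C x) = p" "dim_col (design_mat p n m C x) = n"
  by (simp_all add: design_mat_def)

lemma index_mult_mult_mat:
  fixes U M V :: "'a :: semiring_0 mat"
  assumes "U \<in> carrier_mat n n" "M \<in> carrier_mat n n" "V \<in> carrier_mat n n" "r < n" "s < n"
  shows "(U * M * V) $$ (r, s) = (\<Sum>b<n. \<Sum>a<n. U $$ (r, a) * M $$ (a, b) * V $$ (b, s))"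
  using assms by (simp add: scalar_prod_def lessThan_atLeast0 sum_distrib_right del: assoc_mult_mat)

text \<open>Designs are linear in the variables, so constant factors act on each coefficient matrix
  separately and the product is again of the form \<open>design_mat\<close>.\<close>

lemma design_mat_mult:
  assumes U: "U \<in> carrier_mat n n" and V: "V \<in> carrier_mat n n"
  shows "U * design_mat n n m C x * V = design_mat n n m (\<lambda>i r s. (U * coeff_mat n C i * V) $$ (r, s)) x"
proof (rule eq_matI)
  fix r s assume "r < dim_row (design_mat n n m (\<lambda>i r s. (U * coeff_mat n C i * V) $$ (r, s)) x)"
    "s < dim_col (design_mat n n m (\<lambda>i r s. (U * coeff_mat n C i * V) $$ (r, s)) x)"
  then have rs: "r < n" "s < n" by auto
  have "(U * design_mat n n m C x * V) $$ (r, s)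
      = (\<Sum>b<n. \<Sum>a<n. U $$ (r, a) * (\<Sum>i<m. complex_of_real (x i) * C i a b) * V $$ (b, s))"
    unfolding index_mult_mult_mat[OF U design_mat_carrier(1) V rs] by (simp add: design_mat_def)
  also have "\<dots> = (\<Sum>b<n. \<Sum>a<n. \<Sum>i<m. complex_of_real (x i) * (U $$ (r, a) * C i a b * V $$ (b, s)))"
    by (simp add: sum_distrib_left sum_distrib_right ac_simps)
  also have "\<dots> = (\<Sum>b<n. \<Sum>i<m. \<Sum>a<n. complex_of_real (x i) * (U $$ (r, a) * C i a b * V $$ (b, s)))"
    by (intro sum.cong refl sum.swap)
  also have "\<dots> = (\<Sum>i<m. \<Sum>b<n. \<Sum>a<n. complex_of_real (x i) * (U $$ (r, a) * C i a b * V $$ (b, s)))"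
    by (rule sum.swap)
  also have "\<dots> = design_mat n n m (\<lambda>i r s. (U * coeff_mat n C i * V) $$ (r, s)) x $$ (r, s)"
    using rs by (simp add: design_mat_def index_mult_mult_mat[OF U coeff_mat_carrier(1) V rs] sum_distrib_left del: index_mult_mat)
       (simp add: coeff_mat_def)
  finally show "(U * design_mat n n m C x * V) $$ (r, s)
      = design_mat n n m (\<lambda>i r s. (U * coeff_mat n C i * V) $$ (r, s)) x $$ (r, s)" .
qed (use U V in auto)

text \<open>The left factor cancels and the right one conjugates a scalar matrix, which does not
  change it. The families need not be of the form \<open>design_mat\<close>, so this also applies to
  doubles.\<close>

lemma adjoint_mult_self_unitarily_equivalent:
  assumes "unitarily_equivalent n M N" "mat_adjoint (M x) * M x = c \<cdot>\<^sub>m 1\<^sub>m n"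
  shows "mat_adjoint (N x) * N x = c \<cdot>\<^sub>m 1\<^sub>m n"
proof -
  obtain U V where UV: "unitary_mat n U" "unitary_mat n V" and N: "\<And>x. N x = U * M x * V"
    and c: "\<And>x. M x \<in> carrier_mat n n"
    using unitarily_equivalentE[OF unitarily_equivalent_sym[OF assms(1)]] by metis
  note [simp] = unitary_matD[OF UV(1)] unitary_matD[OF UV(2)] carrier_matD[OF c] c
  have "mat_adjoint (N x) * N x = mat_adjoint V * (mat_adjoint (M x) * M x) * V"
    by (simp add: N mat_adjoint_mult[of _ n n _ n] mult_carrier_mat[of _ n n _ n] mult_mat_assoc
        unitary_mat_cancel[OF UV(1)])
  then show ?thesis by (simp add: assms(2))
qed

lemma is_HOD_unitarily_equivalent:
  assumes "is_HOD n n m C" "unitarily_equivalent n (design_mat n n m C) (design_mat n n m C')"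
  shows "is_HOD n n m C'"
  using assms adjoint_mult_self_unitarily_equivalent[OF assms(2)] unfolding is_HOD_def by blast

lemma design_mat_unit:
  assumes "i < m"
  shows "design_mat n n m C (\<lambda>l. if l = i then 1 else 0) = coeff_mat n C i"
proof (rule eq_matI)
  fix r s assume "r < dim_row (coeff_mat n C i)" "s < dim_col (coeff_mat n C i)"
  moreover have "(\<Sum>l<m. complex_of_real (if l = i then 1 else 0) * C l r s) = (\<Sum>l<m. if l = i then C l r s else 0)"
    by (rule sum.cong) auto
  ultimately show "design_mat n n m C (\<lambda>l. if l = i then 1 else 0) $$ (r, s) = coeff_mat n C i $$ (r, s)"
    using assms by (simp add: design_mat_def coeff_mat_def)
qed simp_all

lemma design_mat_unit_add:
  assumes "i < m" "j < m" "i \<noteq> j"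
  shows "design_mat n n m C (\<lambda>l. if l = i \<or> l = j then 1 else 0) = coeff_mat n C i + coeff_mat n C j"
proof (rule eq_matI)
  fix r s assume "r < dim_row (coeff_mat n C i + coeff_mat n C j)" "s < dim_col (coeff_mat n C i + coeff_mat n C j)"
  moreover have "(\<Sum>l<m. complex_of_real (if l = i \<or> l = j then 1 else 0) * C l r s)
      = (\<Sum>l<m. (if l = i then C l r s else 0) + (if l = j then C l r s else 0))"
    by (rule sum.cong) (use assms in auto)
  ultimately show "design_mat n n m C (\<lambda>l. if l = i \<or> l = j then 1 else 0) $$ (r, s) = (coeff_mat n C i + coeff_mat n C j) $$ (r, s)"
    using assms by (simp add: design_mat_def coeff_mat_def sum.distrib)
qed simp_all

text \<open>The defining identity evaluated at a unit vector.\<close>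

lemma is_HOD_unitary_coeff:
  assumes "is_HOD n n m C" "i < m"
  shows "unitary_mat n (coeff_mat n C i)"
proof (rule unitary_mat_leftI)
  let ?x = "\<lambda>l. if l = i then 1 else 0 :: real"
  have "(\<Sum>l<m. (?x l)\<^sup>2) = (\<Sum>l<m. ?x l)" by (rule sum.cong) auto
  then have "(\<Sum>l<m. (?x l)\<^sup>2) = 1" using assms(2) by simp
  then show "mat_adjoint (coeff_mat n C i) * coeff_mat n C i = 1\<^sub>m n"
    using assms(1)[unfolded is_HOD_def, rule_format, of ?x] by (simp only: design_mat_unit[OF assms(2)]) simp
qed simp

text \<open>Polarisation: at the sum of two unit vectors the squares already account for the whole
  right-hand side, so the cross terms cancel.\<close>

lemma is_HOD_anticommute:
  assumes "is_HOD n n m C" "i < m" "j < m" "i \<noteq> j"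
  shows "mat_adjoint (coeff_mat n C i) * coeff_mat n C j + mat_adjoint (coeff_mat n C j) * coeff_mat n C i = 0\<^sub>m n n"
proof -
  let ?A = "coeff_mat n C i" and ?B = "coeff_mat n C j"
  let ?x = "\<lambda>l. if l = i \<or> l = j then 1 else 0 :: real"
  have "(\<Sum>l<m. (?x l)\<^sup>2) = (\<Sum>l<m. (if l = i then 1 else 0) + (if l = j then 1 else 0))"
    by (rule sum.cong) (use assms in auto)
  then have "(\<Sum>l<m. (?x l)\<^sup>2) = 2" using assms by (simp add: sum.distrib)
  then have eq: "mat_adjoint (?A + ?B) * (?A + ?B) = 2 \<cdot>\<^sub>m 1\<^sub>m n"
    using assms(1)[unfolded is_HOD_def, rule_format, of ?x] by (simp only: design_mat_unit_add[OF assms(2-)]) simp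
  note u = unitary_matD(5)[OF is_HOD_unitary_coeff[OF assms(1,2)]] unitary_matD(5)[OF is_HOD_unitary_coeff[OF assms(1,3)]]
  have "mat_adjoint (?A + ?B) * (?A + ?B)
      = mat_adjoint ?A * ?A + mat_adjoint ?B * ?B + (mat_adjoint ?A * ?B + mat_adjoint ?B * ?A)"
    by (rule eq_matI) (auto simp: scalar_prod_def sum.distrib algebra_simps)
  then have *: "2 \<cdot>\<^sub>m 1\<^sub>m n = 1\<^sub>m n + 1\<^sub>m n + (mat_adjoint ?A * ?B + mat_adjoint ?B * ?A)"
    unfolding u eq .
  show ?thesis
  proof (rule eq_matI)
    fix r s assume "r < dim_row (0\<^sub>m n n :: complex mat)" "s < dim_col (0\<^sub>m n n :: complex mat)"
    then have rs: "r < n" "s < n" by auto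
    have "(2 \<cdot>\<^sub>m 1\<^sub>m n) $$ (r, s) = (1\<^sub>m n + 1\<^sub>m n + (mat_adjoint ?A * ?B + mat_adjoint ?B * ?A)) $$ (r, s)"
      by (simp only: *)
    then show "(mat_adjoint ?A * ?B + mat_adjoint ?B * ?A) $$ (r, s) = 0\<^sub>m n n $$ (r, s)"
      using rs by (auto simp del: index_mult_mat(1) split: if_splits)
  qed simp_all
qed

text \<open>Since \<open>E E = - E\<^sup>H E = - 1\<close> and \<open>c * c = - 1\<close>, the
  matrix \<open>c E\<close> is a Hermitian involution. Multiplying its diagonal form by
  \<open>- c\<close> returns to \<open>E\<close> and turns the leading entries \<open>- 1\<close>
  into \<open>c\<close>; the choice of \<open>c\<close> decides which eigenvalue comes
  first.\<close>

lemma skew_unitary_diag: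
  assumes E: "unitary_mat n E" "mat_adjoint E = - E" and c: "c = \<i> \<or> c = - \<i>"
  shows "\<exists>W p. unitary_mat n W \<and> p \<le> n \<and> mat_adjoint W * E * W = sign_diag_mat n p c"
proof -
  note [simp] = unitary_matD[OF E(1)]
  have cc: "c * c = - 1" "cnj c = - c" using c by auto
  have "E * E = (- 1) \<cdot>\<^sub>m (mat_adjoint E * E)" unfolding E(2) by (rule eq_matI) auto
  then have EE: "E * E = (- 1) \<cdot>\<^sub>m 1\<^sub>m n" by simp
  have "\<exists>W p. unitary_mat n W \<and> p \<le> n \<and> c \<cdot>\<^sub>m E = W * sign_diag_mat n p (- 1) * mat_adjoint W"
  proof (rule hermitian_involution_diag)
    show "mat_adjoint (c \<cdot>\<^sub>m E) = c \<cdot>\<^sub>m E"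
      unfolding mat_adjoint_smult cc E(2) by (rule eq_matI) auto
    show "c \<cdot>\<^sub>m E * (c \<cdot>\<^sub>m E) = 1\<^sub>m n" by (simp add: EE cc)
  qed simp
  then obtain W p where W: "unitary_mat n W" "p \<le> n" "c \<cdot>\<^sub>m E = W * sign_diag_mat n p (- 1) * mat_adjoint W"
    by blast
  note [simp] = unitary_matD[OF W(1)]
  have D: "sign_diag_mat n p (- 1) \<in> carrier_mat n n" by (simp add: sign_diag_mat_def)
  note [simp] = carrier_matD[OF D]
  have "E = (- c) \<cdot>\<^sub>m (c \<cdot>\<^sub>m E)" by (simp add: cc)
  also have "mat_adjoint W * \<dots> * W = (- c) \<cdot>\<^sub>m sign_diag_mat n p (- 1)"
    unfolding W(3) by (simp add: mult_mat_assoc unitary_mat_cancel[OF W(1)])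
  also have "\<dots> = sign_diag_mat n p c"
    by (rule eq_matI) (auto simp: sign_diag_mat_def)
  finally show ?thesis using W by blast
qed

text \<open>With \<open>W\<close> diagonalising \<open>A\<^sup>H B\<close>, the factors
  \<open>W\<^sup>H A\<^sup>H\<close> and \<open>W\<close> send \<open>A\<close> to the identity and
  \<open>B\<close> to the diagonal form. The sign of \<open>c\<close> stays free because the base
  case and the halving step order the eigenvalues oppositely.\<close>

lemma is_HOD_normalize:
  assumes H: "is_HOD n n m C" and ab: "a < m" "b < m" "a \<noteq> b" and c: "c = \<i> \<or> c = - \<i>"
  obtains C' p where "is_HOD n n m C'" "unitarily_equivalent n (design_mat n n m C) (design_mat n n m C')"
    "coeff_mat n C' a = 1\<^sub>m n" "p \<le> n" "coeff_mat n C' b = sign_diag_mat n p c"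
proof -
  define A where "A = coeff_mat n C a"
  define B where "B = coeff_mat n C b"
  have uA: "unitary_mat n A" and uB: "unitary_mat n B"
    using is_HOD_unitary_coeff[OF H] ab by (auto simp: A_def B_def)
  note [simp] = unitary_matD[OF uA] unitary_matD[OF uB]
  have uE: "unitary_mat n (mat_adjoint A * B)" by (intro unitary_mat_mult unitary_mat_adjoint uA uB)
  have anti: "mat_adjoint A * B + mat_adjoint B * A = 0\<^sub>m n n"
    using is_HOD_anticommute[OF H ab] by (simp add: A_def B_def)
  \<comment> \<open>For \<open>E = A\<^sup>H B\<close> the anticommutation relation reads
    \<open>E + E\<^sup>H = 0\<close>.\<close>
  have adjE: "mat_adjoint (mat_adjoint A * B) = - (mat_adjoint A * B)"
  proof (rule eq_matI)
    fix r s assume "r < dim_row (- (mat_adjoint A * B))" "s < dim_col (- (mat_adjoint A * B))"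
    moreover have "(mat_adjoint A * B + mat_adjoint B * A) $$ (r, s) = (0\<^sub>m n n :: complex mat) $$ (r, s)" by (simp only: anti)
    ultimately have "(mat_adjoint B * A) $$ (r, s) = - (mat_adjoint A * B) $$ (r, s)"
      by (simp del: index_mult_mat(1) add: eq_neg_iff_add_eq_0 add.commute)
    then show "mat_adjoint (mat_adjoint A * B) $$ (r, s) = (- (mat_adjoint A * B)) $$ (r, s)"
      using \<open>r < _\<close> \<open>s < _\<close> by (simp add: mat_adjoint_mult[of _ n n _ n] del: index_mult_mat(1))
  qed simp_all
  obtain W p where W: "unitary_mat n W" and p: "p \<le> n"
    and D: "mat_adjoint W * (mat_adjoint A * B) * W = sign_diag_mat n p c"
    using skew_unitary_diag[OF uE adjE c] by blast
  note [simp] = unitary_matD[OF W]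
  define U where "U = mat_adjoint W * mat_adjoint A"
  have U: "unitary_mat n U" unfolding U_def by (intro unitary_mat_mult unitary_mat_adjoint uA W)
  define C' where "C' = (\<lambda>i r s. (U * coeff_mat n C i * W) $$ (r, s))"
  have eq: "U * design_mat n n m C x * W = design_mat n n m C' x" for x
    unfolding C'_def by (rule design_mat_mult) (simp_all add: unitary_matD[OF U])
  have "unitarily_equivalent n (design_mat n n m C') (design_mat n n m C)"
    by (rule unitarily_equivalentI[OF _ U W]) (simp_all add: eq)
  then have eqv: "unitarily_equivalent n (design_mat n n m C) (design_mat n n m C')"
    by (rule unitarily_equivalent_sym)
  have coeff: "coeff_mat n C' i = U * coeff_mat n C i * W" for i
    by (rule eq_matI) (simp_all add: coeff_mat_def C'_def unitary_matD[OF U] del: index_mult_mat(1))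
  show thesis
  proof (rule that[OF is_HOD_unitarily_equivalent[OF H eqv] eqv _ p])
    show "coeff_mat n C' a = 1\<^sub>m n"
      unfolding coeff A_def[symmetric] U_def by (simp add: mult_mat_assoc unitary_mat_cancel[OF uA])
    show "coeff_mat n C' b = sign_diag_mat n p c"
      unfolding coeff B_def[symmetric] U_def D[symmetric] by (simp add: mult_mat_assoc)
  qed
qed

subsection \<open>Classification\<close>

lemma sign_diag_mat_carrier [simp]: "sign_diag_mat n p c \<in> carrier_mat n n"
  "dim_row (sign_diag_mat n p c) = n" "dim_col (sign_diag_mat n p c) = n"
  by (simp_all add: sign_diag_mat_def)

lemma mat_adjoint_sign_diag: "mat_adjoint (sign_diag_mat n p c) = sign_diag_mat n p (cnj c)"
  by (rule eq_matI) (auto simp: sign_diag_mat_def)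

lemma sign_diag_mat_mult:
  assumes "X \<in> carrier_mat n n" "r < n" "s < n"
  shows "(sign_diag_mat n p c * X) $$ (r, s) = (if r < p then c else - c) * X $$ (r, s)"
    "(X * sign_diag_mat n p c) $$ (r, s) = X $$ (r, s) * (if s < p then c else - c)"
proof -
  have "(sign_diag_mat n p c * X) $$ (r, s) = (\<Sum>l\<in>{0..<n}. sign_diag_mat n p c $$ (r, l) * X $$ (l, s))"
    using assms by (simp add: scalar_prod_def)
  also have "\<dots> = (\<Sum>l\<in>{0..<n}. if l = r then (if r < p then c else - c) * X $$ (r, s) else 0)"
    by (rule sum.cong) (use assms in \<open>auto simp: sign_diag_mat_def\<close>)
  finally show "(sign_diag_mat n p c * X) $$ (r, s) = (if r < p then c else - c) * X $$ (r, s)"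
    using assms(2) by (simp add: sum.delta)
  have "(X * sign_diag_mat n p c) $$ (r, s) = (\<Sum>l\<in>{0..<n}. X $$ (r, l) * sign_diag_mat n p c $$ (l, s))"
    using assms by (simp add: scalar_prod_def)
  also have "\<dots> = (\<Sum>l\<in>{0..<n}. if l = s then X $$ (r, s) * (if s < p then c else - c) else 0)"
    by (rule sum.cong) (use assms in \<open>auto simp: sign_diag_mat_def\<close>)
  finally show "(X * sign_diag_mat n p c) $$ (r, s) = X $$ (r, s) * (if s < p then c else - c)"
    using assms(3) by (simp add: sum.delta)
qed

text \<open>A unitary matrix with vanishing diagonal blocks maps two complementary coordinate subspaces onto each
  other; summing the squared moduli of its upper right block by rows and by columns compares their dimensions.\<close>

lemma unitary_antidiag_blocks_size:
  assumes u: "unitary_mat n X" and p: "p \<le> n"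
    and zero: "\<And>r s. r < n \<Longrightarrow> s < n \<Longrightarrow> r < p \<longleftrightarrow> s < p \<Longrightarrow> X $$ (r, s) = 0"
  shows "n = p + p"
proof -
  note [simp] = unitary_matD[OF u]
  have split: "sum f {..<n} = sum f {..<p} + sum f {p..<n}" for f :: "nat \<Rightarrow> complex"
    unfolding lessThan_atLeast0 using p by (simp add: sum.atLeastLessThan_concat)
  have row: "(\<Sum>s\<in>{p..<n}. X $$ (r, s) * cnj (X $$ (r, s))) = 1" if "r < p" for r
  proof -
    have "1 = (X * mat_adjoint X) $$ (r, r)" using that p by simp
    also have "\<dots> = (\<Sum>s<n. X $$ (r, s) * cnj (X $$ (r, s)))"
      using that p by (simp add: scalar_prod_def lessThan_atLeast0 del: unitary_matD(6)[OF u])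
    also have "\<dots> = (\<Sum>s\<in>{p..<n}. X $$ (r, s) * cnj (X $$ (r, s)))"
      unfolding split using that p zero by simp
    finally show ?thesis by simp
  qed
  have col: "(\<Sum>r<p. X $$ (r, s) * cnj (X $$ (r, s))) = 1" if "p \<le> s" "s < n" for s
  proof -
    have "1 = (mat_adjoint X * X) $$ (s, s)" using that p by simp
    also have "\<dots> = (\<Sum>r<n. X $$ (r, s) * cnj (X $$ (r, s)))"
      using that p by (simp add: scalar_prod_def lessThan_atLeast0 mult.commute del: unitary_matD(5)[OF u])
    also have "\<dots> = (\<Sum>r<p. X $$ (r, s) * cnj (X $$ (r, s)))"
      unfolding split using that p zero by simp
    finally show ?thesis by simp
  qed
  have "complex_of_nat p = (\<Sum>r<p. \<Sum>s\<in>{p..<n}. X $$ (r, s) * cnj (X $$ (r, s)))"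
    using row by simp
  also have "\<dots> = (\<Sum>s\<in>{p..<n}. \<Sum>r<p. X $$ (r, s) * cnj (X $$ (r, s)))" by (rule sum.swap)
  also have "\<dots> = complex_of_nat (n - p)" using col by simp
  finally have "p = n - p" by (simp only: of_nat_eq_iff)
  then show ?thesis using p by simp
qed

text \<open>After normalisation the last two variables contribute \<open>diag(cnj z, z)\<close>,
  while the other coefficients are skew-Hermitian and block antidiagonal. The design thus has rows
  \<open>(cnj z, - D\<^sup>H)\<close> and \<open>(D, z)\<close>, and the signed exchange
  \<open>J\<close> of the row blocks relates it to \<open>hdouble z D\<close>.\<close>

lemma is_HOD_halve:
  assumes "is_HOD n n (2 * Suc (Suc j)) C"
  obtains p Q where "n = p + p" "is_HOD p p (2 * Suc j) Q"
    "unitarily_equivalent n (design_mat n n (2 * Suc (Suc j)) C)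
       (\<lambda>x. hdouble (new_var j x) (design_mat p p (2 * Suc j) Q x))"
proof -
  let ?m = "2 * Suc (Suc j)"
  define ia where "ia = 2 * j + 2"
  define ib where "ib = 2 * j + 3"
  have m: "?m = Suc (Suc ia)" "2 * Suc j = ia" "ib = Suc ia"
    by (simp_all add: ia_def ib_def)
  have ab: "ia < ?m" "ib < ?m" "ia \<noteq> ib" by (simp_all add: ia_def ib_def)
  obtain C' p where H: "is_HOD n n ?m C'" and eqv: "unitarily_equivalent n (design_mat n n ?m C) (design_mat n n ?m C')"
    and a: "coeff_mat n C' ia = 1\<^sub>m n" and p: "p \<le> n" and b: "coeff_mat n C' ib = sign_diag_mat n p (- \<i>)"
    using is_HOD_normalize[OF assms ab, of "- \<i>"] by metis
  have coeff: "coeff_mat n C' i $$ (r, s) = C' i r s" if "r < n" "s < n" for i r s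
    using that by (simp add: coeff_mat_def)
  \<comment> \<open>Anticommutation with the coefficient that is now the identity.\<close>
  have skew: "C' i r s = - cnj (C' i s r)" if "i < ia" "r < n" "s < n" for i r s
  proof -
    have im: "i < ?m" "ia \<noteq> i" using that(1) by (simp_all add: ia_def)
    have "(coeff_mat n C' i + mat_adjoint (coeff_mat n C' i)) $$ (r, s) = 0\<^sub>m n n $$ (r, s)"
      using is_HOD_anticommute[OF H ab(1) im(1,2)] by (simp add: a)
    then show ?thesis using that by (simp add: coeff eq_neg_iff_add_eq_0)
  qed
  \<comment> \<open>Anticommutation with the diagonal coefficient: for two indices in the same
    eigenspace both terms agree and add up to a nonzero multiple of the entry.\<close>
  have zero: "C' i r s = 0" if "i < ia" "r < n" "s < n" "r < p \<longleftrightarrow> s < p" for i r s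
  proof -
    have im: "i < ?m" "ib \<noteq> i" using that(1) by (simp_all add: ia_def ib_def)
    have "(sign_diag_mat n p \<i> * coeff_mat n C' i + mat_adjoint (coeff_mat n C' i) * sign_diag_mat n p (- \<i>)) $$ (r, s)
        = 0\<^sub>m n n $$ (r, s)"
      using is_HOD_anticommute[OF H ab(2) im(1,2)] by (simp add: b mat_adjoint_sign_diag)
    then have "(if r < p then \<i> else - \<i>) * C' i r s + cnj (C' i s r) * (if s < p then - \<i> else - (- \<i>)) = 0"
      using that(2,3) by (simp add: sign_diag_mat_mult coeff del: index_mult_mat(1) split del: if_split)
    moreover have "cnj (C' i s r) = - C' i r s" using skew[OF that(1-3)] by simp
    ultimately show ?thesis using that(4) by (auto split: if_splits)
  qed
  \<comment> \<open>At least four variables are present, so coefficient 0 differs from the two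
    normalised ones; it is unitary with vanishing diagonal blocks.\<close>
  have "0 < ia" by (simp add: ia_def)
  then have n: "n = p + p"
    by (intro unitary_antidiag_blocks_size[OF is_HOD_unitary_coeff[OF H, of 0] p]) (simp_all add: coeff zero)
  \<comment> \<open>The half-size design is the lower left block, whence the row shift by
    \<open>p\<close>.\<close>
  define Q where "Q = (\<lambda>i r s. C' i (r + p) s)"
  define D where "D = design_mat p p (ia) Q"
  have D [simp]: "D x \<in> carrier_mat p p" "dim_row (D x) = p" "dim_col (D x) = p" for x by (simp_all add: D_def)
  define J :: "complex mat" where "J = four_block_mat (0\<^sub>m p p) ((- 1) \<cdot>\<^sub>m 1\<^sub>m p) (1 \<cdot>\<^sub>m 1\<^sub>m p) (0\<^sub>m p p)"
  have J: "unitary_mat n J" unfolding J_def n by (rule unitary_mat_block_antidiag) simp_all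
  have a': "C' ia r s = (if r = s then 1 else 0)" if "r < n" "s < n" for r s
    using coeff[OF that, of ia] that unfolding a by simp
  have b': "C' ib r s = (if r = s then if r < p then - \<i> else \<i> else 0)" if "r < n" "s < n" for r s
    using coeff[OF that, of ib] that unfolding b by (auto simp: sign_diag_mat_def split: if_splits)
  have JD: "J * hdouble (new_var j x) (D x) = four_block_mat (cnj (new_var j x) \<cdot>\<^sub>m 1\<^sub>m p) ((- 1) \<cdot>\<^sub>m mat_adjoint (D x))
      (D x) (new_var j x \<cdot>\<^sub>m 1\<^sub>m p)" for x
    by (simp add: J_def hdouble_def mult_four_block_mat[of _ p p _ p _ p _ _ p _ p])
  have eq: "design_mat n n ?m C' x = J * hdouble (new_var j x) (D x) * 1\<^sub>m n" for x
  proof -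
    have c: "J * hdouble (new_var j x) (D x) \<in> carrier_mat n n" unfolding JD n by simp
    have z: "cnj (new_var j x) = complex_of_real (x ia) - \<i> * complex_of_real (x ib)"
      "new_var j x = complex_of_real (x ia) + \<i> * complex_of_real (x ib)"
      by (simp_all add: new_var_def complex_eq_iff ia_def ib_def)
    have "design_mat n n ?m C' x = J * hdouble (new_var j x) (D x)"
    proof (rule eq_matI)
      fix r s assume "r < dim_row (J * hdouble (new_var j x) (D x))" "s < dim_col (J * hdouble (new_var j x) (D x))"
      then have rs: "r < n" "s < n" using c by auto
      have lhs: "design_mat n n ?m C' x $$ (r, s) = (\<Sum>i<ia. complex_of_real (x i) * C' i r s)
          + complex_of_real (x ia) * C' ia r s + complex_of_real (x ib) * C' ib r s"
        using rs unfolding design_mat_def m(1) by (simp add: m(3))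
      consider "r < p" "s < p" | "r < p" "p \<le> s" | "p \<le> r" "s < p" | "p \<le> r" "p \<le> s" by linarith
      then show "design_mat n n ?m C' x $$ (r, s) = (J * hdouble (new_var j x) (D x)) $$ (r, s)"
      proof cases
        case 1
        then show ?thesis unfolding lhs JD using rs by (simp add: zero a' b' z)
      next
        case 2
        \<comment> \<open>Skewness expresses the upper right block through the lower left
          one.\<close>
        have "(\<Sum>i<ia. complex_of_real (x i) * C' i r s) = - cnj (\<Sum>i<ia. complex_of_real (x i) * C' i s r)"
          using skew[OF _ rs] by (simp add: sum_negf[symmetric])
        then show ?thesis unfolding lhs JD using rs 2 n by (simp add: a' b' D_def design_mat_def Q_def)
      next
        case 3
        then show ?thesis unfolding lhs JD using rs n by (simp add: a' b' D_def design_mat_def Q_def)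
      next
        case 4
        then show ?thesis unfolding lhs JD using rs n by (auto simp: zero a' b' z)
      qed
    qed (use c in auto)
    then show ?thesis using right_mult_one_mat[OF c] by (simp only:)
  qed
  have eqv': "unitarily_equivalent n (design_mat n n ?m C') (\<lambda>x. hdouble (new_var j x) (D x))"
    by (rule unitarily_equivalentI[OF _ J unitary_mat_one eq]) (simp add: n)
  have "is_HOD p p (ia) Q"
    unfolding is_HOD_def
  proof
    fix x :: "nat \<Rightarrow> real"
    \<comment> \<open>Setting the two newest variables to 0 reduces the double to
      \<open>diag(D, D\<^sup>H)\<close>, whose upper left block yields the identity for
      \<open>D\<close>.\<close>
    define y where "y = (\<lambda>i. if i < ia then x i else 0)"
    have sq: "(\<Sum>i<?m. (y i)\<^sup>2) = (\<Sum>i<ia. (x i)\<^sup>2)" unfolding m(1) by (simp add: y_def)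
    have Dy: "D y = D x" by (rule eq_matI) (simp_all add: D_def design_mat_def y_def)
    have z: "new_var j y = 0" by (simp add: new_var_def y_def complex_eq_iff ia_def)
    have "mat_adjoint (hdouble 0 (D x)) * hdouble 0 (D x) = complex_of_real (\<Sum>i<ia. (x i)\<^sup>2) \<cdot>\<^sub>m 1\<^sub>m n"
      using adjoint_mult_self_unitarily_equivalent[OF eqv', of y] H[unfolded is_HOD_def, rule_format, of y]
      unfolding Dy z sq by blast
    moreover have "hdouble 0 (D x) = four_block_mat (D x) (0\<^sub>m p p) (0\<^sub>m p p) (mat_adjoint (D x))"
      unfolding hdouble_def by (rule cong_four_block_mat) (auto intro!: eq_matI)
    moreover have "c \<cdot>\<^sub>m 1\<^sub>m n = four_block_mat (c \<cdot>\<^sub>m 1\<^sub>m p) (0\<^sub>m p p) (0\<^sub>m p p) (c \<cdot>\<^sub>m 1\<^sub>m p)" for c :: complex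
      unfolding n by (rule eq_matI) auto
    ultimately have "four_block_mat (mat_adjoint (D x) * D x) (0\<^sub>m p p) (0\<^sub>m p p) (D x * mat_adjoint (D x))
       = four_block_mat (complex_of_real (\<Sum>i<ia. (x i)\<^sup>2) \<cdot>\<^sub>m 1\<^sub>m p) (0\<^sub>m p p) (0\<^sub>m p p)
           (complex_of_real (\<Sum>i<ia. (x i)\<^sup>2) \<cdot>\<^sub>m 1\<^sub>m p)"
      by (simp add: mat_adjoint_four_block[of _ p p _ p _ p] mult_four_block_mat[of _ p p _ p _ p _ _ p _ p])
    from four_block_mat_eqD(1)[OF this, of p p p p]
    show "mat_adjoint (design_mat p p (ia) Q x) * design_mat p p (ia) Q x
        = complex_of_real (\<Sum>i<ia. (x i)\<^sup>2) \<cdot>\<^sub>m 1\<^sub>m p"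
      unfolding D_def[symmetric] by (simp add: mult_carrier_mat[of _ p p _ p])
  qed
  then show thesis
    using that[unfolded m(2), OF n _ unitarily_equivalent_trans[OF eqv eqv'[unfolded D_def]]] by blast
qed

lemma HOD_classification:
  "is_HOD n n (2 * Suc j) C \<Longrightarrow> \<exists>n1 n2. n = (n1 + n2) * 2 ^ j \<and>
     unitarily_equivalent n (design_mat n n (2 * Suc j) C) (canonical_design (Suc j) n1 n2)"
proof (induction j arbitrary: n C)
  case 0
  note One_nat_def [simp del]
  have ab: "0 < 2 * Suc 0" "1 < 2 * Suc 0" "(0 :: nat) \<noteq> 1" by simp_all
  obtain C' p where eqv: "unitarily_equivalent n (design_mat n n (2 * Suc 0) C) (design_mat n n (2 * Suc 0) C')"
    and a: "coeff_mat n C' 0 = 1\<^sub>m n" and p: "p \<le> n" and b: "coeff_mat n C' 1 = sign_diag_mat n p \<i>"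
    using is_HOD_normalize[OF 0 ab, of "\<i>"] by metis
  \<comment> \<open>The eigenvalues \<open>\<i>\<close> give the copies of \<open>Hmat\<close> and
    the eigenvalues \<open>- \<i>\<close> those of \<open>Hminus\<close>, so \<open>p\<close> and
    \<open>n - p\<close> are the multiplicities.\<close>
  have "design_mat n n (2 * Suc 0) C' x = canonical_design 1 p (n - p) x" for x
  proof (rule eq_matI)
    fix r s assume "r < dim_row (canonical_design 1 p (n - p) x)" "s < dim_col (canonical_design 1 p (n - p) x)"
    then have rs: "r < n" "s < n" using p by (simp_all add: canonical_design_1)
    have "C' 0 r s = coeff_mat n C' 0 $$ (r, s)" "C' 1 r s = coeff_mat n C' 1 $$ (r, s)"
      using rs by (simp_all add: coeff_mat_def)
    then have "C' 0 r s = (if r = s then 1 else 0)" "C' 1 r s = (if r = s then if r < p then \<i> else - \<i> else 0)"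
      using rs unfolding a b by (simp_all add: sign_diag_mat_def)
    then show "design_mat n n (2 * Suc 0) C' x $$ (r, s) = canonical_design 1 p (n - p) x $$ (r, s)"
      unfolding canonical_design_1 using rs p
      by (simp add: design_mat_def numeral_2_eq_2 complex_eq_iff One_nat_def)
  qed (use p in \<open>simp_all add: canonical_design_1\<close>)
  then have "design_mat n n (2 * Suc 0) C' = canonical_design (Suc 0) p (n - p)"
    unfolding One_nat_def[symmetric] by blast
  with eqv have "unitarily_equivalent n (design_mat n n (2 * Suc 0) C) (canonical_design (Suc 0) p (n - p))" by simp
  moreover have "n = (p + (n - p)) * 2 ^ 0" using p by simp
  ultimately show ?case by blast
next
  case (Suc j)
  obtain p Q where n: "n = p + p" and Q: "is_HOD p p (2 * Suc j) Q"
    and eqv: "unitarily_equivalent n (design_mat n n (2 * Suc (Suc j)) C)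
       (\<lambda>x. hdouble (new_var j x) (design_mat p p (2 * Suc j) Q x))"
    using is_HOD_halve[OF Suc.prems] by metis
  obtain n1 n2 where p: "p = (n1 + n2) * 2 ^ j"
    and eqv': "unitarily_equivalent p (design_mat p p (2 * Suc j) Q) (canonical_design (Suc j) n1 n2)"
    using Suc.IH[OF Q] by blast
  have n': "n = (n1 + n2) * 2 ^ Suc j" using n p by simp
  note eqv
  also have "unitarily_equivalent n (\<lambda>x. hdouble (new_var j x) (design_mat p p (2 * Suc j) Q x))
      (\<lambda>x. hdouble (new_var j x) (canonical_design (Suc j) n1 n2 x))"
    unfolding n by (rule unitarily_equivalent_hdouble[OF eqv'])
  also have "unitarily_equivalent n \<dots> (canonical_design (Suc (Suc j)) n1 n2)"
    unfolding n' by (rule hdouble_canonical_design)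
  finally show ?case using n' by blast
qed

section \<open>Existence of designs by repeated doubling\<close>

lemma hdouble_design_mat:
  "\<exists>C'. \<forall>x. design_mat (p + p) (p + p) (2 * Suc (Suc j)) C' x
     = hdouble (new_var j x) (design_mat p p (2 * Suc j) C x)"
proof -
  \<comment> \<open>Coefficients read off block by block. A double is linear over the reals despite
    the conjugations; the lower left scalar \<open>- cnj z\<close> explains the pair
    \<open>- 1\<close>, \<open>\<i>\<close> opposite to \<open>1\<close>,
    \<open>\<i>\<close>.\<close>
  define C' where "C' i r s =
    (if r < p \<and> s < p then if i < 2 * Suc j then C i r s else 0
     else if p \<le> r \<and> p \<le> s then if i < 2 * Suc j then cnj (C i (s - p) (r - p)) else 0
     else if r < p then if s = r + p then if i = 2 * Suc j then 1 else if i = Suc (2 * Suc j) then \<i> else 0 else 0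
     else if r = s + p then if i = 2 * Suc j then - 1 else if i = Suc (2 * Suc j) then \<i> else 0 else 0)"
    for i r s
  have m: "2 * Suc (Suc j) = Suc (Suc (2 * Suc j))" by simp
  have "design_mat (p + p) (p + p) (2 * Suc (Suc j)) C' x = hdouble (new_var j x) (design_mat p p (2 * Suc j) C x)" for x
  proof (rule eq_matI)
    let ?D = "design_mat p p (2 * Suc j) C x"
    fix r s assume "r < dim_row (hdouble (new_var j x) ?D)" "s < dim_col (hdouble (new_var j x) ?D)"
    then have rs: "r < p + p" "s < p + p" by (simp_all add: hdouble_def)
    have z: "new_var j x = complex_of_real (x (2 * Suc j)) + \<i> * complex_of_real (x (Suc (2 * Suc j)))"
      by (simp add: new_var_def complex_eq_iff eval_nat_numeral)
    have lhs: "design_mat (p + p) (p + p) (2 * Suc (Suc j)) C' x $$ (r, s) = (\<Sum>i<2 * Suc j. complex_of_real (x i) * C' i r s)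
        + complex_of_real (x (2 * Suc j)) * C' (2 * Suc j) r s + complex_of_real (x (Suc (2 * Suc j))) * C' (Suc (2 * Suc j)) r s"
      using rs unfolding design_mat_def m by simp
    consider "r < p" "s < p" | "r < p" "p \<le> s" | "p \<le> r" "s < p" | "p \<le> r" "p \<le> s" by linarith
    then show "design_mat (p + p) (p + p) (2 * Suc (Suc j)) C' x $$ (r, s) = hdouble (new_var j x) ?D $$ (r, s)"
      unfolding lhs hdouble_def
      by cases (use rs in \<open>auto simp: C'_def design_mat_def z simp del: mult_Suc_right\<close>)
  qed (simp_all add: hdouble_def)
  then show ?thesis by blast
qed

text \<open>The cross terms cancel. One diagonal block of each product involves
  \<open>A\<^sup>H A\<close> and the other \<open>A A\<^sup>H\<close>, so both orders enter and both
  are carried along.\<close>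

lemma hdouble_mult_adjoint:
  assumes A: "A \<in> carrier_mat p p" and s: "mat_adjoint A * A = s \<cdot>\<^sub>m 1\<^sub>m p" "A * mat_adjoint A = s \<cdot>\<^sub>m 1\<^sub>m p"
  shows "mat_adjoint (hdouble z A) * hdouble z A = (s + z * cnj z) \<cdot>\<^sub>m 1\<^sub>m (p + p)"
    "hdouble z A * mat_adjoint (hdouble z A) = (s + z * cnj z) \<cdot>\<^sub>m 1\<^sub>m (p + p)"
proof -
  note [simp] = A carrier_matD[OF A]
  have one: "four_block_mat (c \<cdot>\<^sub>m 1\<^sub>m p) (0\<^sub>m p p) (0\<^sub>m p p) (c \<cdot>\<^sub>m 1\<^sub>m p) = c \<cdot>\<^sub>m 1\<^sub>m (p + p)" for c :: complex
    by (rule eq_matI) auto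
  have zero: "0 \<cdot>\<^sub>m B = 0\<^sub>m (dim_row B) (dim_col B)" for B :: "complex mat" by (rule eq_matI) auto
  have add: "c \<cdot>\<^sub>m B + d \<cdot>\<^sub>m B = (c + d) \<cdot>\<^sub>m B" for c d :: complex and B
    by (rule eq_matI) (auto simp: algebra_simps)
  show "mat_adjoint (hdouble z A) * hdouble z A = (s + z * cnj z) \<cdot>\<^sub>m 1\<^sub>m (p + p)"
    "hdouble z A * mat_adjoint (hdouble z A) = (s + z * cnj z) \<cdot>\<^sub>m 1\<^sub>m (p + p)"
    by (simp_all add: hdouble_def mat_adjoint_four_block[of _ p p _ p _ p] mult_four_block_mat[of _ p p _ p _ p _ _ p _ p]
        mat_adjoint_smult s zero add one[symmetric] algebra_simps)
qed

text \<open>Start from a scalar matrix of size \<open>m\<close> and double \<open>j\<close> times.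
  The product in the other order is included to make the induction go through.\<close>

lemma HOD_exists:
  "\<exists>C. \<forall>x. let D = design_mat (m * 2 ^ j) (m * 2 ^ j) (2 * Suc j) C x; c = complex_of_real (\<Sum>i<2 * Suc j. (x i)\<^sup>2) in
     mat_adjoint D * D = c \<cdot>\<^sub>m 1\<^sub>m (m * 2 ^ j) \<and> D * mat_adjoint D = c \<cdot>\<^sub>m 1\<^sub>m (m * 2 ^ j)"
proof (induction j)
  case 0
  define C :: "nat \<Rightarrow> nat \<Rightarrow> nat \<Rightarrow> complex" where "C i r s = (if r = s then if i = 0 then 1 else \<i> else 0)" for i r s
  have D: "design_mat m m 2 C x = Complex (x 0) (x 1) \<cdot>\<^sub>m 1\<^sub>m m" for x
    by (rule eq_matI) (auto simp: design_mat_def C_def numeral_2_eq_2 complex_eq_iff)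
  have "Complex a b * cnj (Complex a b) = complex_of_real (a\<^sup>2 + b\<^sup>2)" for a b
    by (simp add: complex_eq_iff power2_eq_square)
  then show ?case
    by (intro exI[of _ C]) (simp add: D mat_adjoint_smult Let_def numeral_2_eq_2[symmetric] mult.commute, simp add: numeral_2_eq_2)
next
  case (Suc j)
  let ?p = "m * 2 ^ j"
  obtain C where C: "mat_adjoint (design_mat ?p ?p (2 * Suc j) C x) * design_mat ?p ?p (2 * Suc j) C x
        = complex_of_real (\<Sum>i<2 * Suc j. (x i)\<^sup>2) \<cdot>\<^sub>m 1\<^sub>m ?p"
      "design_mat ?p ?p (2 * Suc j) C x * mat_adjoint (design_mat ?p ?p (2 * Suc j) C x)
        = complex_of_real (\<Sum>i<2 * Suc j. (x i)\<^sup>2) \<cdot>\<^sub>m 1\<^sub>m ?p" for x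
    using Suc unfolding Let_def by metis
  obtain C' where C': "design_mat (?p + ?p) (?p + ?p) (2 * Suc (Suc j)) C' x
      = hdouble (new_var j x) (design_mat ?p ?p (2 * Suc j) C x)" for x
    using hdouble_design_mat by blast
  have n: "m * 2 ^ Suc j = ?p + ?p" by simp
  have m: "2 * Suc (Suc j) = Suc (Suc (2 * Suc j))" by simp
  have sq: "complex_of_real (\<Sum>i<2 * Suc (Suc j). (x i)\<^sup>2)
      = complex_of_real (\<Sum>i<2 * Suc j. (x i)\<^sup>2) + new_var j x * cnj (new_var j x)" for x
    unfolding m by (simp add: new_var_def complex_eq_iff power2_eq_square eval_nat_numeral)
  show ?case
    unfolding n Let_def sq
    by (intro exI[of _ C'] allI conjI; unfold C'; rule hdouble_mult_adjoint[OF _ C]; simp)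
qed

theorem theorem2:
  fixes n k :: nat
  assumes "n \<ge> 1" and "k \<ge> 1"
  shows "((\<exists>C. is_HOD n n (2*k) C) \<longleftrightarrow> 2^(k-1) dvd n)
    \<and> (\<forall>C. is_HOD n n (2*k) C \<longrightarrow>
         (\<exists>!(n1, n2). n1 + n2 = n div 2^(k-1) \<and>
            (\<exists>U V. unitary_mat n U \<and> unitary_mat n V \<and>
               (\<forall>x. design_mat n n (2*k) C x =
                  U * diag_block_mat (replicate n1 (Hmat k x) @ replicate n2 (Hminus k x)) * V))))"
proof -
  obtain j where k: "k = Suc j" using assms(2) by (cases k) auto
  have dvd: "2 ^ j dvd n" if "is_HOD n n (2 * Suc j) C" for C
    using HOD_classification[OF that] by auto
  have ex: "\<exists>C. is_HOD n n (2 * Suc j) C" if d: "2 ^ j dvd n"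
  proof -
    obtain m where n: "n = m * 2 ^ j" using d by (auto simp: dvd_def mult.commute)
    obtain C where "\<And>x. mat_adjoint (design_mat n n (2 * Suc j) C x) * design_mat n n (2 * Suc j) C x
        = complex_of_real (\<Sum>i<2 * Suc j. (x i)\<^sup>2) \<cdot>\<^sub>m 1\<^sub>m n"
      using HOD_exists[of m j] unfolding Let_def n[symmetric] by blast
    then show ?thesis unfolding is_HOD_def by blast
  qed
  \<comment> \<open>Once the sizes match, the dimension condition inside
    \<open>unitarily_equivalent\<close> holds automatically.\<close>
  have eqv: "unitarily_equivalent n (design_mat n n (2 * Suc j) C) (canonical_design (Suc j) n1 n2) \<longleftrightarrow>
      (\<exists>U V. unitary_mat n U \<and> unitary_mat n V \<and> (\<forall>x. design_mat n n (2 * Suc j) C x =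
         U * diag_block_mat (replicate n1 (Hmat (Suc j) x) @ replicate n2 (Hminus (Suc j) x)) * V))"
    if "n = (n1 + n2) * 2 ^ j" for C n1 n2
    unfolding unitarily_equivalent_def that using canonical_design_carrier unfolding canonical_design_def by blast
  have decomp: "\<exists>!(n1, n2). n1 + n2 = n div 2 ^ j \<and> (\<exists>U V. unitary_mat n U \<and> unitary_mat n V \<and>
      (\<forall>x. design_mat n n (2 * Suc j) C x =
         U * diag_block_mat (replicate n1 (Hmat (Suc j) x) @ replicate n2 (Hminus (Suc j) x)) * V))"
    if H: "is_HOD n n (2 * Suc j) C" for C
  proof -
    obtain n1 n2 where n: "n = (n1 + n2) * 2 ^ j"
      and e: "unitarily_equivalent n (design_mat n n (2 * Suc j) C) (canonical_design (Suc j) n1 n2)"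
      using HOD_classification[OF H] by blast
    have nd: "n1 + n2 = n div 2 ^ j" using n by simp
    define P where "P m1 m2 \<longleftrightarrow> m1 + m2 = n div 2 ^ j \<and> (\<exists>U V. unitary_mat n U \<and> unitary_mat n V \<and>
      (\<forall>x. design_mat n n (2 * Suc j) C x =
         U * diag_block_mat (replicate m1 (Hmat (Suc j) x) @ replicate m2 (Hminus (Suc j) x)) * V))" for m1 m2
    have P: "P n1 n2" unfolding P_def using nd e eqv[OF n] by blast
    have uniq: "m1 = n1 \<and> m2 = n2" if "P m1 m2" for m1 m2
    proof -
      have m: "m1 + m2 = n div 2 ^ j" using that by (simp add: P_def)
      then have nm: "n = (m1 + m2) * 2 ^ j" using n nd by metis
      then have "unitarily_equivalent n (design_mat n n (2 * Suc j) C) (canonical_design (Suc j) m1 m2)"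
        using eqv[OF nm] that unfolding P_def by blast
      \<comment> \<open>Two decompositions of the same design compose to an equivalence between two
        canonical designs.\<close>
      from unitarily_equivalent_trans[OF unitarily_equivalent_sym[OF e] this]
      have "n1 = m1" unfolding n by (rule canonical_design_unique) (simp only: nd m)
      then show ?thesis using nd m by simp
    qed
    have "\<exists>!(m1, m2). P m1 m2"
    proof (rule ex1I[of _ "(n1, n2)"])
      show "case (n1, n2) of (m1, m2) \<Rightarrow> P m1 m2" using P by simp
      show "y = (n1, n2)" if "case y of (m1, m2) \<Rightarrow> P m1 m2" for y
        using uniq[of "fst y" "snd y"] that by (cases y) simp
    qed
    then show ?thesis unfolding P_def .
  qed
  show ?thesis
    unfolding k diff_Suc_1 using dvd ex decomp by blast
qed

end
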